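(* Let $N\ge 5$ be an odd integer and let $\epsilon>0$. Consider the planar autonomous system with real parameter $r>0$ and state $(x_1,w)\in\mathbb{R}^2$, $$\epsilon\frac{dx_1}{dt}=w+x_1(x_1-1),\qquad \frac{dw}{dt}=-\sum_{n=1}^{N}x_1^n+r .$$ This system has a Hopf bifurcation, with respect to the parameter $r$, at $r=\sum_{n=1}^{N}(1/2)^n$.
   Context: The parameters $N$ and $\epsilon$ are fixed and $r$ is the bifurcation parameter. "Hopf bifurcation at $r=r_c$" is meant in the standard sense for a smooth one-parameter family of planar vector fields: there is a smooth branch of equilibria defined for $r$ near $r_c$ whose linearization has a pair of complex conjugate eigenvalues crossing the imaginary axis, with nonzero speed in $r$ and at nonzero purely imaginary values, at $r=r_c$; and a family of nonconstant periodic orbits of the system (for parameter values tending to $r_c$) emanates from the equilibrium at $r=r_c$, shrinking to it. *)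

theory Defs
  imports "HOL-Analysis.Analysis"
begin

(* Only used on open sets S, where the Frechet derivative at a point of S is determined by f on S.
   All directional derivatives along fixed vectors are iterated, so that for open S and finite
   dimension this is the usual class C^k. *)
primrec Ck_on ::
  "nat \<Rightarrow> 'a::euclidean_space set \<Rightarrow> ('a \<Rightarrow> 'b::real_normed_vector) \<Rightarrow> bool" where
  "Ck_on 0 S f \<longleftrightarrow> continuous_on S f"
| "Ck_on (Suc k) S f \<longleftrightarrow>
     (\<forall>x\<in>S. f differentiable (at x)) \<and>
     (\<forall>v. Ck_on k S (\<lambda>x. frechet_derivative f (at x) v))"

definition smooth_on ::
  "'a::euclidean_space set \<Rightarrow> ('a \<Rightarrow> 'b::real_normed_vector) \<Rightarrow> bool" where
  "smooth_on S f \<longleftrightarrow> (\<forall>k. Ck_on k S f)"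

definition complex_eigenvalue :: "real ^ 'n ^ 'n \<Rightarrow> complex \<Rightarrow> bool" where
  "complex_eigenvalue A l \<longleftrightarrow>
     (\<exists>v :: complex ^ 'n. v \<noteq> 0 \<and> (\<chi> i j. complex_of_real (A $ i $ j)) *v v = l *s v)"

definition nonconstant_periodic_solution ::
  "('a::real_normed_vector \<Rightarrow> 'a) \<Rightarrow> (real \<Rightarrow> 'a) \<Rightarrow> bool" where
  "nonconstant_periodic_solution f x \<longleftrightarrow>
     (\<forall>t. (x has_vector_derivative f (x t)) (at t)) \<and>
     (\<exists>T>0. \<forall>t. x (t + T) = x t) \<and>
     (\<exists>t. x t \<noteq> x 0)"

(* F r is the vector field at parameter r, and I is the range of the parameter. The branch of
   equilibria is z, and mu, cnj mu are the eigenvalues of the linearization along it. The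
   periodic orbits form a continuous one-parameter family: p s is the parameter value and
   x s the periodic solution belonging to 0 < s < s0, and s tends to 0 at the bifurcation. *)
definition hopf_bifurcation ::
  "real set \<Rightarrow> (real \<Rightarrow> real ^ 2 \<Rightarrow> real ^ 2) \<Rightarrow> real \<Rightarrow> bool" where
  "hopf_bifurcation I F rc \<longleftrightarrow>
     open I \<and> rc \<in> I \<and>
     smooth_on (I \<times> UNIV) (\<lambda>(r, y). F r y) \<and>
     (\<exists>e>0. \<exists>z :: real \<Rightarrow> real ^ 2. \<exists>mu :: real \<Rightarrow> complex. \<exists>d.
        ball rc e \<subseteq> I \<and>
        smooth_on (ball rc e) z \<and>
        (\<forall>r\<in>ball rc e. F r (z r) = 0) \<and>
        (\<forall>r\<in>ball rc e.
           complex_eigenvalue (jacobian (F r) (at (z r))) (mu r) \<and>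
           complex_eigenvalue (jacobian (F r) (at (z r))) (cnj (mu r)) \<and>
           Im (mu r) > 0) \<and>
        Re (mu rc) = 0 \<and>
        ((\<lambda>r. Re (mu r)) has_real_derivative d) (at rc) \<and> d \<noteq> 0 \<and>
        (\<exists>s0>0. \<exists>p :: real \<Rightarrow> real. \<exists>x :: real \<Rightarrow> real \<Rightarrow> real ^ 2.
           continuous_on {0<..<s0} p \<and>
           continuous_on ({0<..<s0} \<times> UNIV) (\<lambda>(s, t). x s t) \<and>
           (\<forall>s\<in>{0<..<s0}. p s \<in> I \<and> nonconstant_periodic_solution (F (p s)) (x s)) \<and>
           (p \<longlongrightarrow> rc) (at_right 0) \<and>
           uniform_limit UNIV x (\<lambda>t. z rc) (at_right 0)))"

definition planar_field :: "nat \<Rightarrow> real \<Rightarrow> real \<Rightarrow> real ^ 2 \<Rightarrow> real ^ 2" where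
  "planar_field N \<epsilon> r y =
     (let x1 = y $ 1; w = y $ 2
      in vector [(w + x1 * (x1 - 1)) / \<epsilon>, - (\<Sum>n=1..N. x1 ^ n) + r])"

end

theory Submission
  imports Defs "HOL-Computational_Algebra.Polynomial"
begin

text \<open>
  The damping of this Lienard system at the equilibrium with first coordinate \<open>a\<close> is proportional to
  \<open>1 - 2 a\<close>, so it changes sign at \<open>a = 1/2\<close>, and the equilibrium sits there exactly when
  \<open>r = (\<Sum>n=1..N. (1/2) ^ n)\<close>. Since \<open>x \<mapsto> (\<Sum>n=1..N. x ^ n)\<close> increases with positive derivative on the
  positive half line, \<open>a\<close> is a smooth increasing function of \<open>r > 0\<close>, and the eigenvalues, which solve
  \<open>\<epsilon> l\<^sup>2 - (2 a - 1) l + q = 0\<close> with \<open>q > 0\<close> the derivative of the power sum at \<open>a\<close>, cross the imaginary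
  axis at nonzero speed. What takes work is the family of periodic orbits.

  Let \<open>s > 0\<close> be the amplitude, \<open>1/2 + s \<beta>\<close> the first coordinate of the equilibrium, \<open>\<omega>\<close> the frequency
  at the bifurcation and \<open>\<omega> / (1 + s \<sigma>)\<close> the frequency of the sought orbit. In coordinates centred at
  the equilibrium, scaled by \<open>s\<close>, and with time scaled so that the period becomes \<open>2 * pi\<close>, the system
  becomes \<open>z' = (1 + s \<sigma>) (\<i> z + s f(z))\<close> for a complex valued \<open>z\<close>, where \<open>f\<close> also depends on \<open>s\<close>
  and \<open>\<beta>\<close>. The phase is fixed by starting at \<open>z = 1\<close>. Writing \<open>z = cis t * (1 + s r)\<close> leaves
  \<open>r' = \<Phi>(t, l) + s \<Psi>(s, t, r, l)\<close>, where the one complex number \<open>l\<close> encodes the two real unknowns \<open>\<beta>\<close>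
  and \<open>\<sigma>\<close>. The quadratic terms of \<open>f\<close> average to zero along the unit circle, and \<open>l\<close> is chosen so that
  the mean of \<open>\<Phi>\<close> over a period is exactly \<open>l\<close> (\<open>rotating_frame_identity\<close>).

  A solution \<open>r\<close> is therefore periodic precisely if \<open>l\<close> is \<open>- s\<close> times the mean of \<open>\<Psi>\<close> along the orbit. Take
  as the unknown the periodic function \<open>\<psi>(t) = \<Psi>(s, t, r(t), l)\<close>. It determines \<open>l\<close>, and then \<open>r\<close> by
  integration, in such a way that both depend on \<open>\<psi>\<close> only through a factor \<open>s\<close>. So the equation for
  \<open>\<psi>\<close> is a contraction on a ball of bounded continuous functions once \<open>s\<close> is small, and its fixed
  point is Lipschitz in \<open>s\<close> (\<open>periodic_perturbation\<close>). This gives a continuous family of orbits at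
  distance \<open>O(s)\<close> from the equilibrium (\<open>periodic_orbit_family\<close>).
\<close>

section \<open>Smoothness of polynomial maps and of solution branches\<close>

text \<open>
  Polynomial functions are closed under directional derivatives, so all iterated derivatives exist
  and are continuous; this is how \<open>Ck_on\<close> is obtained for every order.
\<close>

lemma real_polynomial_function_has_derivative:
  fixes f :: "'a::real_normed_vector \<Rightarrow> real"
  assumes "real_polynomial_function f"
  shows "\<exists>f'. (\<forall>x. (f has_derivative f' x) (at x)) \<and> (\<forall>v. real_polynomial_function (\<lambda>x. f' x v))"
  using assms
proof (induction f)
  case (linear f)
  then show ?case
    by (intro exI[of _ "\<lambda>_. f"]) (auto intro: bounded_linear_imp_has_derivative)
next
  case (const c)
  show ?case by (intro exI[of _ "\<lambda>_ _. 0"]) auto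
next
  case (add f g)
  then obtain f' g' where "\<And>x. (f has_derivative f' x) (at x)" "\<And>v. real_polynomial_function (\<lambda>x. f' x v)"
    "\<And>x. (g has_derivative g' x) (at x)" "\<And>v. real_polynomial_function (\<lambda>x. g' x v)"
    by blast
  then show ?case
    by (intro exI[of _ "\<lambda>x v. f' x v + g' x v"]) (auto intro: has_derivative_add)
next
  case (mult f g)
  then obtain f' g' where "\<And>x. (f has_derivative f' x) (at x)" "\<And>v. real_polynomial_function (\<lambda>x. f' x v)"
    "\<And>x. (g has_derivative g' x) (at x)" "\<And>v. real_polynomial_function (\<lambda>x. g' x v)"
    by blast
  with mult.hyps show ?case
    by (intro exI[of _ "\<lambda>x v. f x * g' x v + f' x v * g x"] conjI allI has_derivative_mult
        real_polynomial_function.intros(3,4))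
qed

lemma polynomial_function_has_derivative:
  fixes f :: "'a::real_normed_vector \<Rightarrow> 'b::euclidean_space"
  assumes "polynomial_function f"
  obtains f' where "\<And>x. (f has_derivative f' x) (at x)" "\<And>v. polynomial_function (\<lambda>x. f' x v)"
proof -
  have "\<forall>b\<in>Basis. \<exists>f'. (\<forall>x. ((\<lambda>x. f x \<bullet> b) has_derivative f' x) (at x)) \<and>
          (\<forall>v. real_polynomial_function (\<lambda>x. f' x v))"
    using assms real_polynomial_function_has_derivative
    by (auto simp: polynomial_function_iff_Basis_inner)
  then obtain D where D: "\<And>b x. b \<in> Basis \<Longrightarrow> ((\<lambda>x. f x \<bullet> b) has_derivative D b x) (at x)"
      "\<And>b v. b \<in> Basis \<Longrightarrow> real_polynomial_function (\<lambda>x. D b x v)"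
    by metis
  show thesis
  proof (rule that)
    show "(f has_derivative (\<lambda>v. \<Sum>b\<in>Basis. D b x v *\<^sub>R b)) (at x)" for x
      by (subst has_derivative_componentwise_within) (simp add: D(1) inner_sum_left_Basis)
    show "polynomial_function (\<lambda>x. \<Sum>b\<in>Basis. D b x v *\<^sub>R b)" for v
      by (simp add: polynomial_function_iff_Basis_inner D(2) inner_sum_left_Basis)
  qed
qed

lemma Ck_on_polynomial_function:
  fixes f :: "'a::euclidean_space \<Rightarrow> 'b::euclidean_space"
  assumes "polynomial_function f"
  shows "Ck_on k S f"
  using assms
proof (induction k arbitrary: f)
  case 0
  then show ?case by (simp add: continuous_on_polymonial_function)
next
  case (Suc k)
  obtain f' where f': "\<And>x. (f has_derivative f' x) (at x)" "\<And>v. polynomial_function (\<lambda>x. f' x v)"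
    using polynomial_function_has_derivative[OF Suc.prems] by blast
  have "frechet_derivative f (at x) = f' x" for x
    using frechet_derivative_at[OF f'(1)] by simp
  then show ?case
    using f' Suc.IH by (auto simp: differentiable_def)
qed

text \<open>
  On an open set a derivative depends only on the values in that set. The equilibrium branch has
  closed formulas for its derivatives only near the bifurcation, so this locality is needed at every
  order.
\<close>

lemma Ck_on_cong:
  assumes "open S" "\<And>x. x \<in> S \<Longrightarrow> f x = g x" "Ck_on k S g"
  shows "Ck_on k S f"
  using assms(2,3)
proof (induction k arbitrary: f g)
  case 0
  then show ?case using continuous_on_cong[of S S f g] by simp
next
  case (Suc k)
  have der: "(f has_derivative frechet_derivative g (at x)) (at x)" if "x \<in> S" for x
    by (rule has_derivative_transform_within_open[OF _ \<open>open S\<close> that])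
       (use Suc.prems that in \<open>auto simp: frechet_derivative_works\<close>)
  then have "frechet_derivative f (at x) = frechet_derivative g (at x)" if "x \<in> S" for x
    using frechet_derivative_at that by metis
  with der Suc show ?case
    by (auto simp: differentiable_def intro: Suc.IH)
qed

text \<open>
  If \<open>a' = 1 / D(a)\<close>, as for the inverse of a function with derivative \<open>D\<close>, then differentiating
  \<open>P(a) / D(a) ^ m\<close> gives \<open>Q(a) / D(a) ^ (m + 2)\<close> with \<open>Q = D P' - m D' P\<close>. This class of functions is
  closed under differentiation, and \<open>m = 0\<close> gives the smoothness of every polynomial in \<open>a\<close>.
\<close>

lemma Ck_on_rational_solution:
  fixes a D :: "real \<Rightarrow> real" and P :: "real \<Rightarrow> 'b::euclidean_space"
  assumes "open S" and D: "polynomial_function D"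
    and a: "\<And>r. r \<in> S \<Longrightarrow> (a has_real_derivative inverse (D (a r))) (at r)"
    and nz: "\<And>r. r \<in> S \<Longrightarrow> D (a r) \<noteq> 0"
    and P: "polynomial_function P"
  shows "Ck_on k S (\<lambda>r. inverse (D (a r)) ^ m *\<^sub>R P (a r))"
  using P
proof (induction k arbitrary: P m)
  case 0
  have "continuous_on S a"
    using a by (meson DERIV_isCont continuous_at_imp_continuous_on)
  moreover have "continuous_on T D" "continuous_on T P" for T
    using D "0.prems" by (auto simp: continuous_on_polymonial_function)
  ultimately show ?case
    using nz by (auto intro!: continuous_intros intro: continuous_on_compose2[where g=D] continuous_on_compose2[where g=P])
next
  case (Suc k)
  obtain D' where D': "polynomial_function D'" "\<And>x. (D has_real_derivative D' x) (at x)"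
    using has_vector_derivative_polynomial_function[OF D] by (metis has_real_derivative_iff_has_vector_derivative)
  obtain P' where P': "polynomial_function P'" "\<And>x. (P has_vector_derivative P' x) (at x)"
    using has_vector_derivative_polynomial_function[OF Suc.prems] by metis
  define Q where "Q v x = v *\<^sub>R (D x *\<^sub>R P' x - (real m * D' x) *\<^sub>R P x)" for v x
  have Q: "polynomial_function (Q v)" for v
    unfolding Q_def using D D' P' Suc.prems polynomial_function_cmul[OF D'(1), of "real m"]
    by (intro polynomial_function_cmul polynomial_function_diff polynomial_function_mult) auto
  have der: "((\<lambda>r. inverse (D (a r)) ^ m *\<^sub>R P (a r)) has_derivative
      (\<lambda>v. inverse (D (a r)) ^ (m + 2) *\<^sub>R Q v (a r))) (at r)" if r: "r \<in> S" for r
  proof -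
    have Da: "((\<lambda>r. D (a r)) has_real_derivative D' (a r) * inverse (D (a r))) (at r)"
      by (rule DERIV_chain2[OF D'(2) a[OF r]])
    have 1: "((\<lambda>r. inverse (D (a r)) ^ m) has_real_derivative
        - (real m * D' (a r) * inverse (D (a r)) ^ (m + 2))) (at r)"
      using DERIV_power[OF DERIV_inverse'[OF Da nz[OF r]], of m]
      by (cases m) (simp_all add: mult_ac)
    have 2: "((\<lambda>r. P (a r)) has_vector_derivative inverse (D (a r)) *\<^sub>R P' (a r)) (at r)"
      using vector_diff_chain_at[of a "inverse (D (a r))" r P "P' (a r)"] P'(2) a[OF r]
      by (simp add: o_def has_real_derivative_iff_has_vector_derivative)
    have "((\<lambda>r. inverse (D (a r)) ^ m *\<^sub>R P (a r)) has_vector_derivative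
        inverse (D (a r)) ^ m *\<^sub>R inverse (D (a r)) *\<^sub>R P' (a r) +
        (- (real m * D' (a r) * inverse (D (a r)) ^ (m + 2))) *\<^sub>R P (a r)) (at r)"
      by (rule has_vector_derivative_scaleR[OF 1 2])
    moreover have "v *\<^sub>R (inverse (D (a r)) ^ m *\<^sub>R inverse (D (a r)) *\<^sub>R P' (a r) +
        (- (real m * D' (a r) * inverse (D (a r)) ^ (m + 2))) *\<^sub>R P (a r)) =
        inverse (D (a r)) ^ (m + 2) *\<^sub>R Q v (a r)" for v
      using nz[OF r] by (simp add: Q_def algebra_simps power_add power2_eq_square)
    ultimately show ?thesis
      by (simp only: has_vector_derivative_def)
  qed
  have "frechet_derivative (\<lambda>r. inverse (D (a r)) ^ m *\<^sub>R P (a r)) (at r) =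
      (\<lambda>v. inverse (D (a r)) ^ (m + 2) *\<^sub>R Q v (a r))" if "r \<in> S" for r
    using frechet_derivative_at[OF der[OF that]] by simp
  then have "Ck_on k S (\<lambda>r. frechet_derivative (\<lambda>r. inverse (D (a r)) ^ m *\<^sub>R P (a r)) (at r) v)" for v
    by (intro Ck_on_cong[OF \<open>open S\<close> _ Suc.IH[OF Q, of "m + 2" v]]) auto
  then show ?case
    using der by (auto simp: differentiable_def)
qed

section \<open>Power sums and their inverse\<close>

lemma polynomial_function_power_sum_deriv:
  "polynomial_function (\<lambda>x::real. \<Sum>n=1..N. real n * x ^ (n - 1))"
  unfolding real_polynomial_function_eq[symmetric]
  by (intro real_polynomial_function_sum real_polynomial_function.intros(4) real_polynomial_function_power) (auto intro: real_polynomial_function.intros(1))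

lemma has_real_derivative_power_sum:
  "((\<lambda>x::real. \<Sum>n=1..N. x ^ n) has_real_derivative (\<Sum>n=1..N. real n * x ^ (n - 1))) (at x)"
  by (auto intro!: derivative_eq_intros)

lemma power_sum_deriv_pos:
  assumes "N \<ge> 1" "x \<ge> (0::real)"
  shows "(\<Sum>n=1..N. real n * x ^ (n - 1)) > 0"
proof -
  have "(\<Sum>n=1..N. real n * x ^ (n - 1)) = 1 + (\<Sum>n=Suc 1..N. real n * x ^ (n - 1))"
    using assms by (subst sum.atLeast_Suc_atMost) auto
  moreover have "(\<Sum>n=Suc 1..N. real n * x ^ (n - 1)) \<ge> 0"
    using assms by (intro sum_nonneg) auto
  ultimately show ?thesis by linarith
qed

lemma power_sum_inverse:
  assumes "N \<ge> 1"
  obtains a :: "real \<Rightarrow> real" where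
    "\<And>r. r > 0 \<Longrightarrow> a r > 0" "\<And>r. r > 0 \<Longrightarrow> (\<Sum>n=1..N. a r ^ n) = r"
    "\<And>x. x > 0 \<Longrightarrow> a (\<Sum>n=1..N. x ^ n) = x"
    "\<And>r. r > 0 \<Longrightarrow> (a has_real_derivative inverse (\<Sum>n=1..N. real n * a r ^ (n - 1))) (at r)"
proof -
  define g where "g x = (\<Sum>n=1..N. x ^ n)" for x :: real
  have dg: "(g has_real_derivative (\<Sum>n=1..N. real n * x ^ (n - 1))) (at x)" for x
    unfolding g_def by (rule has_real_derivative_power_sum)
  have cont: "isCont g x" for x
    by (rule DERIV_isCont[OF dg])
  have mono: "g x < g y" if "0 \<le> x" "x < y" for x y
  proof (rule DERIV_pos_imp_increasing[OF \<open>x < y\<close>])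
    fix t assume "x \<le> t"
    then show "\<exists>D. (g has_real_derivative D) (at t) \<and> D > 0"
      using dg power_sum_deriv_pos[OF assms, of t] that by auto
  qed
  have inj: "inj_on g {0<..}"
    by (rule inj_onI) (metis mono greaterThan_iff less_irrefl linorder_neqE_linordered_idom order.strict_implies_order)
  have g0: "g 0 = 0"
    by (simp add: g_def power_0_left)
  have surj: "\<exists>x>0. g x = r" if "r > 0" for r
  proof -
    have "g r \<ge> r"
      using member_le_sum[of 1 "{1..N}" "\<lambda>n. r ^ n"] that assms by (simp add: g_def)
    then have "\<exists>x\<ge>0. x \<le> r \<and> g x = r"
      using that g0 cont by (intro IVT) auto
    then show ?thesis
      using g0 that by (metis less_le)
  qed
  define a where "a = inv_into {0<..} g"
  have ga: "a r > 0" "g (a r) = r" if "r > 0" for r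
  proof -
    have "r \<in> g ` {0<..}" using surj[OF that] by force
    then show "a r > 0" "g (a r) = r"
      unfolding a_def using inv_into_into[of r g "{0<..}"] f_inv_into_f[of r g "{0<..}"] by auto
  qed
  have ag: "a (g x) = x" if "x > 0" for x
    using inv_into_f_f[OF inj] that by (simp add: a_def)
  have conta: "isCont a r" if "r > 0" for r
  proof -
    have "isCont a (g (a r))"
      by (rule isCont_inverse_function2[of "a r / 2" _ "2 * a r"]) (use ga(1)[OF that] ag cont in auto)
    then show ?thesis using ga that by simp
  qed
  have "(a has_real_derivative inverse (\<Sum>n=1..N. real n * a r ^ (n - 1))) (at r)" if "r > 0" for r
    by (rule DERIV_inverse_function[OF dg _ that, of _ "r + 1"])
       (use that ga conta power_sum_deriv_pos[OF assms, of "a r"] in \<open>auto simp: less_imp_le\<close>)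
  then show thesis
    using that[of a] ga ag by (simp add: g_def)
qed

text \<open>
  The cubic remainder is kept as an exact polynomial, so that the rescaled equation is polynomial in
  the unknowns and in the amplitude.
\<close>

lemma poly_second_order_expansion:
  fixes p :: "real poly"
  obtains c2 q where "\<And>h. poly p (c + h) = poly p c + poly (pderiv p) c * h + c2 * h ^ 2 + h ^ 3 * poly q h"
proof -
  define P where "P = pcompose p [:c, 1:]"
  obtain a0 a1 a2 q where P: "P = pCons a0 (pCons a1 (pCons a2 q))"
    by (metis pCons_cases)
  have "poly p (c + h) = a0 + h * (a1 + h * (a2 + h * poly q h))" for h
    using arg_cong[OF P, of "\<lambda>p. poly p h"] by (simp add: P_def poly_pcompose)
  moreover from this[of 0] have "a0 = poly p c" by simp
  moreover have "pderiv P = pcompose (pderiv p) [:c, 1:]"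
    by (simp add: P_def pderiv_pcompose pderiv_pCons)
  then have "a1 = poly (pderiv p) c"
    by (metis P add.right_neutral mult_zero_left pderiv_pCons poly_0 poly_add poly_pCons poly_pcompose)
  ultimately show thesis
    by (intro that[of a2 q]) (simp add: power2_eq_square power3_eq_cube algebra_simps)
qed

lemma power_sum_expansion:
  obtains c2 q where "\<And>h. (\<Sum>n=1..N. (c + h) ^ n) =
    (\<Sum>n=1..N. c ^ n) + (\<Sum>n=1..N. real n * c ^ (n - 1)) * h + c2 * h ^ 2 + h ^ 3 * poly q h"
proof -
  define p :: "real poly" where "p = (\<Sum>n=1..N. monom 1 n)"
  have p: "poly p x = (\<Sum>n=1..N. x ^ n)" for x
    by (simp add: p_def poly_sum poly_monom)
  have "poly (pderiv p) c = (\<Sum>n=1..N. real n * c ^ (n - 1))"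
    using DERIV_unique[OF poly_DERIV[of p c]] has_real_derivative_power_sum[of N c] by (simp add: p[abs_def])
  then show thesis
    using poly_second_order_expansion[of p c] that by (metis p)
qed

section \<open>Smoothness and linearization of the field\<close>

lemma smooth_on_planar_field:
  "smooth_on S (\<lambda>(r, y). planar_field N \<epsilon> r y)"
proof -
  have lin: "real_polynomial_function (\<lambda>p :: real \<times> (real ^ 2). fst p)"
    "real_polynomial_function (\<lambda>p :: real \<times> (real ^ 2). snd p $ i)" for i
    by (auto intro!: real_polynomial_function.intros(1) bounded_linear_fst
        bounded_linear_compose[OF bounded_linear_vec_nth bounded_linear_snd])
  have "real_polynomial_function (\<lambda>p :: real \<times> (real ^ 2).
      (snd p $ 2 + snd p $ 1 * (snd p $ 1 - 1)) / \<epsilon>)"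
    by (intro real_polynomial_function_divide real_polynomial_function.intros(3,4) lin
        real_polynomial_function_diff real_polynomial_function.intros(2))
  moreover have "real_polynomial_function (\<lambda>p :: real \<times> (real ^ 2).
      - (\<Sum>n=1..N. (snd p $ 1) ^ n) + fst p)"
    by (intro real_polynomial_function.intros(3) real_polynomial_function_minus
        real_polynomial_function_sum real_polynomial_function_power lin) auto
  ultimately have "polynomial_function (\<lambda>(r, y). planar_field N \<epsilon> r y)"
    unfolding polynomial_function_iff_Basis_inner Basis_vec_def
    by (auto simp: planar_field_def Let_def inner_axis split_beta UNIV_2)
  then show ?thesis
    by (simp add: smooth_on_def Ck_on_polynomial_function)
qed

lemma jacobian_planar_field:
  "jacobian (planar_field N \<epsilon> r) (at y) =
    vector [vector [(2 * y $ 1 - 1) / \<epsilon>, 1 / \<epsilon>], vector [- (\<Sum>n=1..N. real n * (y $ 1) ^ (n - 1)), 0]]"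
  (is "_ = ?A")
proof -
  have nth: "((\<lambda>y :: real ^ 2. y $ i) has_derivative (\<lambda>h. h $ i)) (at y)" for i
    by (rule bounded_linear_imp_has_derivative[OF bounded_linear_vec_nth])
  have "((\<lambda>y. (y $ 2 + y $ 1 * (y $ 1 - 1)) / \<epsilon>) has_derivative
      (\<lambda>h. (h $ 2 + (y $ 1 * h $ 1 + h $ 1 * (y $ 1 - 1))) / \<epsilon>)) (at y)"
    using bounded_linear.has_derivative[OF bounded_linear_divide[of \<epsilon>]
        has_derivative_add[OF nth[of 2] has_derivative_mult[OF nth[of 1]
        has_derivative_diff[OF nth[of 1] has_derivative_const[of 1]]]]]
    by simp
  then have 1: "((\<lambda>y. (y $ 2 + y $ 1 * (y $ 1 - 1)) / \<epsilon>) has_derivative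
      (\<lambda>h. (2 * y $ 1 - 1) / \<epsilon> * h $ 1 + 1 / \<epsilon> * h $ 2)) (at y)"
    by (rule has_derivative_eq_rhs) (simp add: fun_eq_iff add_divide_distrib diff_divide_distrib algebra_simps)
  have "((\<lambda>y. \<Sum>n=1..N. (y $ 1) ^ n) has_derivative
      (\<lambda>h. (\<Sum>n=1..N. real n * (y $ 1) ^ (n - 1)) * h $ 1)) (at y)"
    using has_derivative_compose[OF nth[of 1], of "\<lambda>x. \<Sum>n=1..N. x ^ n"]
      has_real_derivative_power_sum[of N "y $ 1"]
    by (auto simp: has_field_derivative_def)
  from has_derivative_add[OF has_derivative_minus[OF this] has_derivative_const[of r]]
  have 2: "((\<lambda>y. - (\<Sum>n=1..N. (y $ 1) ^ n) + r) has_derivative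
      (\<lambda>h. - (\<Sum>n=1..N. real n * (y $ 1) ^ (n - 1)) * h $ 1)) (at y)"
    by simp
  have "(planar_field N \<epsilon> r has_derivative (\<lambda>h. ?A *v h)) (at y)"
    using 1 2
    by (subst has_derivative_componentwise_within)
       (auto simp: Basis_vec_def inner_axis planar_field_def Let_def matrix_vector_mult_def sum_2 UNIV_2)
  then show ?thesis
    by (simp add: jacobian_def frechet_derivative_at[symmetric])
qed

text \<open>
  An eigenvector is \<open>(b, l - p)\<close>: the first row is then an identity, and the second row is the
  characteristic equation.
\<close>

lemma complex_eigenvalue_companion:
  assumes "l ^ 2 - of_real p * l + of_real (q * b) = 0" "b \<noteq> 0"
  shows "complex_eigenvalue (vector [vector [p, b], vector [- q, 0]] :: real ^ 2 ^ 2) l"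
proof -
  let ?v = "vector [of_real b, l - of_real p] :: complex ^ 2"
  have "?v \<noteq> 0"
    using assms(2) by (metis of_real_eq_0_iff vector_2(1) zero_index)
  moreover have "l * (l - of_real p) = - of_real q * of_real b"
    using assms(1) by (simp add: algebra_simps power2_eq_square add_eq_0_iff)
  then have "(\<chi> i j. complex_of_real ((vector [vector [p, b], vector [- q, 0]] :: real ^ 2 ^ 2) $ i $ j)) *v ?v = l *s ?v"
    by (simp add: vec_eq_iff forall_2 matrix_vector_mult_def sum_2 algebra_simps)
  ultimately show ?thesis
    unfolding complex_eigenvalue_def by blast
qed

lemma focus_eigenvalue:
  assumes "\<epsilon> \<noteq> 0" "D ^ 2 = 4 * \<epsilon> * q - (2 * a - 1) ^ 2"
  shows "complex_eigenvalue (vector [vector [(2 * a - 1) / \<epsilon>, 1 / \<epsilon>], vector [- q, 0]] :: real ^ 2 ^ 2)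
    (Complex ((2 * a - 1) / (2 * \<epsilon>)) (D / (2 * \<epsilon>)))"
proof (rule complex_eigenvalue_companion)
  define \<alpha> \<delta> where "\<alpha> = (2 * a - 1) / (2 * \<epsilon>)" and "\<delta> = D / (2 * \<epsilon>)"
  have "\<alpha> ^ 2 + \<delta> ^ 2 = (4 * \<epsilon> * q) / (4 * \<epsilon> ^ 2)"
    using assms(2) by (simp add: \<alpha>_def \<delta>_def power_divide add_divide_distrib[symmetric] power_mult_distrib)
  then have "q * (1 / \<epsilon>) = \<alpha> ^ 2 + \<delta> ^ 2"
    using assms(1) by (simp add: power2_eq_square)
  moreover have "(2 * a - 1) / \<epsilon> = 2 * \<alpha>"
    using assms(1) by (simp add: \<alpha>_def field_simps)
  ultimately show "Complex ((2 * a - 1) / (2 * \<epsilon>)) (D / (2 * \<epsilon>)) ^ 2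
      - of_real ((2 * a - 1) / \<epsilon>) * Complex ((2 * a - 1) / (2 * \<epsilon>)) (D / (2 * \<epsilon>)) + of_real (q * (1 / \<epsilon>)) = 0"
    unfolding \<alpha>_def[symmetric] \<delta>_def[symmetric]
    by (simp add: complex_eq_iff power2_eq_square)
qed (use assms(1) in simp)

section \<open>Mean and oscillation of periodic functions\<close>

text \<open>
  Characterized by its derivative on the whole line, so that negative arguments are treated like
  positive ones and all estimates come from the mean value inequality.
\<close>

definition antiderivative :: "(real \<Rightarrow> 'a::euclidean_space) \<Rightarrow> real \<Rightarrow> 'a" where
  "antiderivative f = (SOME F. F 0 = 0 \<and> (\<forall>t. (F has_vector_derivative f t) (at t)))"

definition circle_mean :: "(real \<Rightarrow> 'a::euclidean_space) \<Rightarrow> 'a" where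
  "circle_mean f = antiderivative f (2 * pi) /\<^sub>R (2 * pi)"

text \<open>
  The antiderivative of the mean-free part of \<open>f\<close>. It is periodic whenever \<open>f\<close> is.
\<close>

definition oscillation :: "(real \<Rightarrow> 'a::euclidean_space) \<Rightarrow> real \<Rightarrow> 'a" where
  "oscillation f t = antiderivative f t - t *\<^sub>R circle_mean f"

lemma antiderivative:
  fixes f :: "real \<Rightarrow> 'a::euclidean_space"
  assumes "continuous_on UNIV f"
  shows "antiderivative f 0 = 0" "(antiderivative f has_vector_derivative f t) (at t)"
proof -
  obtain G where G: "\<And>t. (G has_vector_derivative f t) (at t)"
    using einterval_antiderivative[of "-\<infinity>" "\<infinity>" f] assms
    by (auto simp: continuous_on_eq_continuous_at)
  have "\<exists>F. F 0 = 0 \<and> (\<forall>t. (F has_vector_derivative f t) (at t))"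
    using G by (intro exI[of _ "\<lambda>t. G t - G 0"]) (auto intro!: derivative_eq_intros)
  from someI_ex[OF this] show "antiderivative f 0 = 0" "(antiderivative f has_vector_derivative f t) (at t)"
    by (auto simp: antiderivative_def)
qed

lemma norm_diff_le_of_vector_derivative:
  fixes f :: "real \<Rightarrow> 'a::euclidean_space"
  assumes "\<And>t. (f has_vector_derivative f' t) (at t)" "\<And>t. norm (f' t) \<le> B"
  shows "norm (f x - f y) \<le> B * \<bar>x - y\<bar>"
proof -
  have "norm (f x - f y) \<le> B * norm (x - y)"
  proof (rule differentiable_bound[of UNIV f "\<lambda>t h. h *\<^sub>R f' t"])
    show "onorm (\<lambda>h. h *\<^sub>R f' t) \<le> B" for t
    proof (rule onorm_le)
      show "norm (h *\<^sub>R f' t) \<le> B * norm h" for h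
        using mult_left_mono[OF assms(2)[of t], of "\<bar>h\<bar>"] by (simp add: mult.commute)
    qed
  qed (use assms(1) in \<open>auto simp: has_vector_derivative_def\<close>)
  then show ?thesis by simp
qed

lemma antiderivative_unique:
  fixes f :: "real \<Rightarrow> 'a::euclidean_space"
  assumes "continuous_on UNIV f" "F 0 = 0" "\<And>t. (F has_vector_derivative f t) (at t)"
  shows "antiderivative f t = F t"
proof -
  have "((\<lambda>t. antiderivative f t - F t) has_vector_derivative f t - f t) (at t)" for t
    by (intro has_vector_derivative_diff antiderivative(2) assms)
  from norm_diff_le_of_vector_derivative[OF this, of 0 t 0] show ?thesis
    using assms antiderivative(1)[OF assms(1)] by simp
qed

lemma antiderivative_diff:
  fixes f g :: "real \<Rightarrow> 'a::euclidean_space"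
  assumes "continuous_on UNIV f" "continuous_on UNIV g"
  shows "antiderivative (\<lambda>t. f t - g t) t = antiderivative f t - antiderivative g t"
  by (rule antiderivative_unique[of "\<lambda>t. f t - g t" "\<lambda>t. antiderivative f t - antiderivative g t"])
     (auto intro!: continuous_intros has_vector_derivative_diff antiderivative assms simp: antiderivative(1) assms)

lemma circle_mean_diff:
  fixes f g :: "real \<Rightarrow> 'a::euclidean_space"
  assumes "continuous_on UNIV f" "continuous_on UNIV g"
  shows "circle_mean (\<lambda>t. f t - g t) = circle_mean f - circle_mean g"
  by (simp add: circle_mean_def antiderivative_diff assms algebra_simps)

lemma oscillation_diff:
  fixes f g :: "real \<Rightarrow> 'a::euclidean_space"
  assumes "continuous_on UNIV f" "continuous_on UNIV g"
  shows "oscillation (\<lambda>t. f t - g t) t = oscillation f t - oscillation g t"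
  by (simp add: oscillation_def antiderivative_diff circle_mean_diff assms algebra_simps)

lemma oscillation_0: "continuous_on UNIV f \<Longrightarrow> oscillation f 0 = 0"
  by (simp add: oscillation_def antiderivative)

lemma oscillation_derivative:
  fixes f :: "real \<Rightarrow> 'a::euclidean_space"
  assumes "continuous_on UNIV f"
  shows "(oscillation f has_vector_derivative f t - circle_mean f) (at t)"
proof -
  have "((\<lambda>t. t *\<^sub>R circle_mean f) has_vector_derivative 1 *\<^sub>R circle_mean f) (at t)"
    using has_vector_derivative_scaleR[of "\<lambda>t. t" 1 t UNIV "\<lambda>_. circle_mean f" 0] by auto
  from has_vector_derivative_diff[OF antiderivative(2)[OF assms, of t] this]
  show ?thesis by (simp add: oscillation_def[abs_def])
qed

text \<open>
  The difference over one period has derivative zero, and subtracting the mean makes it vanish at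
  \<open>0\<close>.
\<close>

lemma oscillation_periodic:
  fixes f :: "real \<Rightarrow> 'a::euclidean_space"
  assumes "continuous_on UNIV f" "\<And>t. f (t + 2 * pi) = f t"
  shows "oscillation f (t + 2 * pi) = oscillation f t"
proof -
  let ?h = "\<lambda>t. oscillation f (t + 2 * pi) - oscillation f t"
  have "((\<lambda>t. oscillation f (t + 2 * pi)) has_vector_derivative f (t + 2 * pi) - circle_mean f) (at t)" for t
    using vector_diff_chain_at[of "\<lambda>t. t + 2 * pi" 1 t "oscillation f" "f (t + 2 * pi) - circle_mean f"]
      oscillation_derivative[OF assms(1), of "t + 2 * pi"]
    by (simp add: o_def has_vector_derivative_add_const)
  then have "(?h has_vector_derivative (f (t + 2 * pi) - circle_mean f) - (f t - circle_mean f)) (at t)" for t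
    by (intro has_vector_derivative_diff oscillation_derivative assms(1))
  from norm_diff_le_of_vector_derivative[OF this, of 0 t 0]
  have "?h t = ?h 0" using assms(2) by simp
  also have "?h 0 = 0"
    using antiderivative(1)[OF assms(1)] by (simp add: oscillation_def circle_mean_def)
  finally show ?thesis by simp
qed

lemma periodic_int_shift:
  fixes f :: "real \<Rightarrow> 'a"
  assumes "\<And>t. f (t + T) = f t"
  shows "f (t + of_int k * T) = f t"
proof (induction k rule: int_induct[where k=0])
  case (step1 i)
  then show ?case using assms[of "t + of_int i * T"] by (simp add: algebra_simps)
next
  case (step2 i)
  then show ?case using assms[of "t + of_int (i - 1) * T"] by (simp add: algebra_simps)
qed simp

lemma norm_circle_mean_le:
  fixes f :: "real \<Rightarrow> 'a::euclidean_space"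
  assumes "continuous_on UNIV f" "\<And>t. norm (f t) \<le> B"
  shows "norm (circle_mean f) \<le> B"
  using norm_diff_le_of_vector_derivative[OF antiderivative(2)[OF assms(1)] assms(2), of "2 * pi" 0]
    antiderivative(1)[OF assms(1)]
  by (simp add: circle_mean_def field_simps)

text \<open>
  By periodicity it is enough to estimate on one period, where the antiderivative and the linear
  correction are each at most \<open>2 * pi * B\<close>.
\<close>

lemma norm_oscillation_le:
  fixes f :: "real \<Rightarrow> 'a::euclidean_space"
  assumes "continuous_on UNIV f" "\<And>t. f (t + 2 * pi) = f t" "\<And>t. norm (f t) \<le> B"
  shows "norm (oscillation f t) \<le> 4 * pi * B"
proof -
  define k where "k = \<lfloor>t / (2 * pi)\<rfloor>"
  define u where "u = t - of_int k * (2 * pi)"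
  have u: "0 \<le> u" "u \<le> 2 * pi"
    using floor_divide_lower[of "2 * pi" t] floor_divide_upper[of "2 * pi" t]
    by (auto simp: u_def k_def algebra_simps)
  have B: "B \<ge> 0"
    using norm_ge_zero assms(3) order_trans by blast
  have "oscillation f t = oscillation f u"
    using periodic_int_shift[of "oscillation f" "2 * pi" u k] oscillation_periodic[OF assms(1,2)]
    by (simp add: u_def)
  also have "norm \<dots> \<le> norm (antiderivative f u) + norm (u *\<^sub>R circle_mean f)"
    unfolding oscillation_def by (rule norm_triangle_ineq4)
  also have "\<dots> \<le> 2 * pi * B + 2 * pi * B"
  proof (rule add_mono)
    have "norm (antiderivative f u) \<le> B * u"
      using norm_diff_le_of_vector_derivative[OF antiderivative(2)[OF assms(1)] assms(3), of u 0]
        antiderivative(1)[OF assms(1)] u by simp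
    then show "norm (antiderivative f u) \<le> 2 * pi * B"
      using mult_left_mono[OF u(2) B] by (simp add: mult.commute)
    show "norm (u *\<^sub>R circle_mean f) \<le> 2 * pi * B"
      using mult_mono[OF u(2) norm_circle_mean_le[OF assms(1,3)]] u by simp
  qed
  finally show ?thesis by (simp add: mult_ac)
qed

section \<open>Periodic solutions of weakly perturbed equations\<close>

text \<open>
  The averaging principle behind the construction. The unperturbed right-hand side is \<open>l + Q' t l\<close>
  with \<open>Q\<close> periodic, so its mean is \<open>l\<close>. For given \<open>\<psi>\<close>, put \<open>l = - s * circle_mean \<psi>\<close> and
  \<open>r t = Q t l + s * oscillation \<psi> t\<close>; then \<open>r\<close> is periodic with \<open>r' = l + Q' t l + s \<psi> t\<close>, and \<open>r\<close>
  solves the equation exactly when \<open>\<psi> t = \<Psi> s t (r t) l\<close>. Since \<open>\<psi>\<close> enters \<open>l\<close> and \<open>r\<close> only with the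
  factor \<open>s\<close>, this is a fixed point problem for a contraction when \<open>s\<close> is small. The same estimate,
  applied to two values of \<open>s\<close>, shows that the solution is Lipschitz in \<open>s\<close>.
\<close>

lemma periodic_perturbation:
  fixes Q Q' :: "real \<Rightarrow> complex \<Rightarrow> complex"
    and \<Psi> :: "real \<Rightarrow> real \<Rightarrow> complex \<Rightarrow> complex \<Rightarrow> complex"
  assumes Q0: "\<And>l. Q 0 l = 0"
    and Q_per: "\<And>t l. Q (t + 2 * pi) l = Q t l"
    and Q_deriv: "\<And>t l. ((\<lambda>t. Q t l) has_vector_derivative Q' t l) (at t)"
    and Q_lip: "\<And>t l m. norm (Q t l - Q t m) \<le> K * norm (l - m)"
    and Q_bound: "\<And>t. norm (Q t 0) \<le> K"
    and \<Psi>_per: "\<And>s t r l. \<Psi> s (t + 2 * pi) r l = \<Psi> s t r l"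
    and \<Psi>_cont: "\<And>s r l. continuous_on UNIV r \<Longrightarrow> continuous_on UNIV (\<lambda>t. \<Psi> s t (r t) l)"
    and \<Psi>_bound: "\<And>R. \<exists>M. \<forall>s t r l. 0 \<le> s \<and> s \<le> 1 \<and> norm r \<le> R \<and> norm l \<le> 1 \<longrightarrow> norm (\<Psi> s t r l) \<le> M"
    and \<Psi>_lip: "\<And>R. \<exists>M. \<forall>s s' t r r' l l'. 0 \<le> s \<and> s \<le> 1 \<and> norm r \<le> R \<and> norm l \<le> 1 \<and>
        0 \<le> s' \<and> s' \<le> 1 \<and> norm r' \<le> R \<and> norm l' \<le> 1 \<longrightarrow>
        norm (\<Psi> s t r l - \<Psi> s' t r' l') \<le> M * (\<bar>s - s'\<bar> + norm (r - r') + norm (l - l'))"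
  obtains s0 C r l where "0 < s0" "s0 \<le> 1"
    "\<And>s t. s \<in> {0..s0} \<Longrightarrow>
      ((r s) has_vector_derivative l s + Q' t (l s) + s *\<^sub>R \<Psi> s t (r s t) (l s)) (at t)"
    "\<And>s t. s \<in> {0..s0} \<Longrightarrow> r s (t + 2 * pi) = r s t" "\<And>s. s \<in> {0..s0} \<Longrightarrow> r s 0 = 0"
    "\<And>s t. s \<in> {0..s0} \<Longrightarrow> norm (r s t) \<le> C" "\<And>s. s \<in> {0..s0} \<Longrightarrow> norm (l s) \<le> C * s"
    "\<And>s s' t. s \<in> {0..s0} \<Longrightarrow> s' \<in> {0..s0} \<Longrightarrow> norm (r s t - r s' t) \<le> C * \<bar>s - s'\<bar>"
    "\<And>s s'. s \<in> {0..s0} \<Longrightarrow> s' \<in> {0..s0} \<Longrightarrow> norm (l s - l s') \<le> C * \<bar>s - s'\<bar>"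
proof -
  have K: "K \<ge> 0"
    using Q_bound[of 0] norm_ge_zero order_trans by blast
  \<comment> \<open>\<open>Q\<close> contributes at most \<open>2 * K\<close> to \<open>r\<close> when \<open>norm l \<le> 1\<close>, and the term with the factor \<open>s\<close> at
     most \<open>1\<close>.\<close>
  define R where "R = 2 * K + 1"
  obtain M1 where M1: "\<And>s t r l. 0 \<le> s \<Longrightarrow> s \<le> 1 \<Longrightarrow> norm r \<le> R \<Longrightarrow> norm l \<le> 1 \<Longrightarrow> norm (\<Psi> s t r l) \<le> M1"
    using \<Psi>_bound[of R] by blast
  obtain M2 where M2: "\<And>s s' t r r' l l'. 0 \<le> s \<Longrightarrow> s \<le> 1 \<Longrightarrow> norm r \<le> R \<Longrightarrow> norm l \<le> 1 \<Longrightarrow>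
        0 \<le> s' \<Longrightarrow> s' \<le> 1 \<Longrightarrow> norm r' \<le> R \<Longrightarrow> norm l' \<le> 1 \<Longrightarrow>
        norm (\<Psi> s t r l - \<Psi> s' t r' l') \<le> M2 * (\<bar>s - s'\<bar> + norm (r - r') + norm (l - l'))"
    using \<Psi>_lip[of R] by metis
  define M where "M = max 1 (max M1 M2)"
  have M: "M \<ge> 1" "M \<ge> M1" "M \<ge> M2" by (auto simp: M_def)
  define c where "c = K + 4 * pi + 1"
  have c: "c \<ge> 1" "c \<ge> 4 * pi" "c > 0" using K by (auto simp: c_def add_nonneg_pos)
  \<comment> \<open>\<open>M * c * s\<close> will be the Lipschitz constant of the fixed point map, so it is at most \<open>1/2\<close>.\<close>
  define s0 where "s0 = 1 / (2 * M * c)"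
  have s0: "s0 > 0" "M * c * s0 = 1 / 2"
    using M c by (auto simp: s0_def field_simps)
  have s0M: "s0 * M \<le> 1" "s0 * (4 * pi * M) \<le> 1" "s0 \<le> 1"
  proof -
    have "s0 * M * 1 \<le> s0 * M * c" "s0 * M * (4 * pi) \<le> s0 * M * c"
      using c s0 M by (auto intro!: mult_left_mono)
    moreover have e: "s0 * M * c = 1 / 2"
      using s0 by (simp add: mult_ac)
    moreover have "s0 * 1 \<le> s0 * M"
      using s0 M by (intro mult_left_mono) auto
    ultimately have "s0 * M \<le> 1" "s0 * M * (4 * pi) \<le> 1" "s0 \<le> 1"
      by linarith+
    then show "s0 * M \<le> 1" "s0 * (4 * pi * M) \<le> 1" "s0 \<le> 1"
      by (simp_all add: mult_ac)
  qed
  define S where "S = {\<psi> :: real \<Rightarrow>\<^sub>C complex. (\<forall>t. apply_bcontfun \<psi> (t + 2 * pi) = apply_bcontfun \<psi> t) \<and> norm \<psi> \<le> M}"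
  have ev_cont: "continuous_on UNIV (\<lambda>\<psi> :: real \<Rightarrow>\<^sub>C complex. apply_bcontfun \<psi> t)" for t
  proof (rule continuous_onI)
    fix \<psi> :: "real \<Rightarrow>\<^sub>C complex" and e :: real assume "e > 0"
    then show "\<exists>d>0. \<forall>\<phi>\<in>UNIV. dist \<phi> \<psi> < d \<longrightarrow> dist (apply_bcontfun \<phi> t) (apply_bcontfun \<psi> t) \<le> e"
      by (intro exI[of _ e]) (auto intro: order_trans[OF dist_bounded])
  qed
  have "S = (\<Inter>t. {\<psi>. apply_bcontfun \<psi> (t + 2 * pi) = apply_bcontfun \<psi> t}) \<inter> cball 0 M"
    by (auto simp: S_def)
  moreover have "closed \<dots>"
    by (intro closed_Int closed_INT ballI closed_Collect_eq ev_cont closed_cball)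
  ultimately have S_complete: "complete S"
    by (simp add: complete_eq_closed)
  have S_ne: "S \<noteq> {}"
    using M by (auto simp: S_def intro!: exI[of _ 0])
  have S_bound: "norm (apply_bcontfun \<psi> t) \<le> M" if "\<psi> \<in> S" for \<psi> t
    using that norm_bounded[of \<psi> t] by (auto simp: S_def)
  have cont: "continuous_on UNIV (apply_bcontfun \<psi>)" for \<psi> :: "real \<Rightarrow>\<^sub>C complex" by simp
  have mean_le: "norm (circle_mean (apply_bcontfun \<psi>)) \<le> M"
    and osc_le: "norm (oscillation (apply_bcontfun \<psi>) t) \<le> 4 * pi * M" if "\<psi> \<in> S" for \<psi> t
    using that S_bound[OF that] by (auto simp: S_def intro!: norm_circle_mean_le norm_oscillation_le)
  have mean_diff: "norm (circle_mean (apply_bcontfun \<psi>) - circle_mean (apply_bcontfun \<phi>)) \<le> norm (\<psi> - \<phi>)"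
    for \<psi> \<phi> :: "real \<Rightarrow>\<^sub>C complex"
    using norm_circle_mean_le[of "\<lambda>t. apply_bcontfun \<psi> t - apply_bcontfun \<phi> t"] norm_bounded[of "\<psi> - \<phi>"]
    by (auto simp: circle_mean_diff[symmetric] intro!: continuous_intros)
  have osc_diff: "norm (oscillation (apply_bcontfun \<psi>) t - oscillation (apply_bcontfun \<phi>) t) \<le> 4 * pi * norm (\<psi> - \<phi>)"
    if "\<psi> \<in> S" "\<phi> \<in> S" for \<psi> \<phi> t
    using norm_oscillation_le[of "\<lambda>t. apply_bcontfun \<psi> t - apply_bcontfun \<phi> t"] norm_bounded[of "\<psi> - \<phi>"] that
    by (auto simp: oscillation_diff[symmetric] S_def intro!: continuous_intros)
  define lam where "lam s \<psi> = - (s *\<^sub>R circle_mean (apply_bcontfun \<psi>))" for s and \<psi> :: "real \<Rightarrow>\<^sub>C complex"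
  define rho where "rho s \<psi> t = Q t (lam s \<psi>) + s *\<^sub>R oscillation (apply_bcontfun \<psi>) t" for s \<psi> t
  define F where "F s \<psi> = Bcontfun (\<lambda>t. \<Psi> s t (rho s \<psi> t) (lam s \<psi>))" for s \<psi>
  have lam_s: "norm (lam s \<psi>) \<le> M * s" if "\<psi> \<in> S" "s \<in> {0..s0}" for s \<psi>
    using mult_right_mono[OF mean_le[OF that(1)], of s] that by (simp add: lam_def mult.commute)
  have lam_1: "norm (lam s \<psi>) \<le> 1" if "\<psi> \<in> S" "s \<in> {0..s0}" for s \<psi>
  proof -
    have "M * s \<le> s0 * M"
      using that M by (subst mult.commute) (auto intro!: mult_right_mono)
    then show ?thesis using lam_s[OF that] s0M by linarith
  qed
  have rho_R: "norm (rho s \<psi> t) \<le> R" if "\<psi> \<in> S" "s \<in> {0..s0}" for s \<psi> t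
  proof -
    have "norm (Q t (lam s \<psi>)) \<le> norm (Q t 0) + norm (Q t (lam s \<psi>) - Q t 0)"
      by (metis add.commute diff_add_cancel norm_triangle_ineq)
    also have "\<dots> \<le> K + K * 1"
      using Q_bound[of t] Q_lip[of t "lam s \<psi>" 0] mult_left_mono[OF lam_1[OF that] K] by auto
    finally have 1: "norm (Q t (lam s \<psi>)) \<le> 2 * K" by simp
    have "norm (s *\<^sub>R oscillation (apply_bcontfun \<psi>) t) \<le> s0 * (4 * pi * M)"
      using osc_le[OF that(1), of t] that by (auto intro!: mult_mono)
    then have "norm (s *\<^sub>R oscillation (apply_bcontfun \<psi>) t) \<le> 1"
      using s0M by linarith
    with 1 show ?thesis
      unfolding rho_def R_def by (intro norm_triangle_le) simp
  qed
  have rho_deriv: "((rho s \<psi>) has_vector_derivative Q' t (lam s \<psi>) + s *\<^sub>R (apply_bcontfun \<psi> t - circle_mean (apply_bcontfun \<psi>))) (at t)" for s \<psi> t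
    unfolding rho_def[abs_def]
    by (intro has_vector_derivative_add Q_deriv bounded_linear.has_vector_derivative[OF bounded_linear_scaleR_right] oscillation_derivative cont)
  have rho_cont: "continuous_on UNIV (rho s \<psi>)" for s \<psi>
    using rho_deriv by (meson continuous_at_imp_continuous_on has_vector_derivative_continuous)
  have rho_per: "rho s \<psi> (t + 2 * pi) = rho s \<psi> t" if "\<psi> \<in> S" for s \<psi> t
    using that by (simp add: rho_def Q_per oscillation_periodic[OF cont] S_def)
  have F_bound: "norm (\<Psi> s t (rho s \<psi> t) (lam s \<psi>)) \<le> M" if "\<psi> \<in> S" "s \<in> {0..s0}" for s \<psi> t
    by (rule order_trans[OF M1 M(2)]) (use that s0M(3) rho_R lam_1 in auto)
  have F_apply: "apply_bcontfun (F s \<psi>) t = \<Psi> s t (rho s \<psi> t) (lam s \<psi>)" if "\<psi> \<in> S" "s \<in> {0..s0}" for s \<psi> t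
    unfolding F_def
    by (subst Bcontfun_inverse) (auto intro!: bcontfun_normI \<Psi>_cont rho_cont F_bound that)
  have F_S: "F s \<psi> \<in> S" if "\<psi> \<in> S" "s \<in> {0..s0}" for s \<psi>
    unfolding S_def mem_Collect_eq
    by (intro conjI allI norm_bound) (simp_all add: F_apply[OF that] F_bound[OF that] \<Psi>_per rho_per[OF that(1)])
  have lam_diff: "norm (lam s \<psi> - lam s' \<phi>) \<le> M * \<bar>s - s'\<bar> + s0 * norm (\<psi> - \<phi>)"
    if "\<psi> \<in> S" "\<phi> \<in> S" "s \<in> {0..s0}" "s' \<in> {0..s0}" for \<psi> \<phi> s s'
  proof -
    have "lam s \<psi> - lam s' \<phi> = (s' - s) *\<^sub>R circle_mean (apply_bcontfun \<psi>)
       + s' *\<^sub>R (circle_mean (apply_bcontfun \<phi>) - circle_mean (apply_bcontfun \<psi>))"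
      by (simp add: lam_def algebra_simps)
    also have "norm \<dots> \<le> \<bar>s - s'\<bar> * M + s0 * norm (\<psi> - \<phi>)"
      using mean_le[OF that(1)] mean_diff[of \<phi> \<psi>] that
      by (intro norm_triangle_le add_mono) (auto intro!: mult_mono simp: norm_minus_commute abs_minus_commute)
    finally show ?thesis by (simp add: mult.commute)
  qed
  have rho_diff: "norm (rho s \<psi> t - rho s' \<phi> t) \<le> (K + 4 * pi) * (M * \<bar>s - s'\<bar> + s0 * norm (\<psi> - \<phi>))"
    if "\<psi> \<in> S" "\<phi> \<in> S" "s \<in> {0..s0}" "s' \<in> {0..s0}" for \<psi> \<phi> s s' t
  proof -
    let ?o = "\<lambda>\<psi>. oscillation (apply_bcontfun \<psi>) t"
    have 1: "norm (Q t (lam s \<psi>) - Q t (lam s' \<phi>)) \<le> K * (M * \<bar>s - s'\<bar> + s0 * norm (\<psi> - \<phi>))"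
      using Q_lip[of t "lam s \<psi>" "lam s' \<phi>"] mult_left_mono[OF lam_diff[OF that] K] by linarith
    have "s *\<^sub>R ?o \<psi> - s' *\<^sub>R ?o \<phi> = (s - s') *\<^sub>R ?o \<psi> + s' *\<^sub>R (?o \<psi> - ?o \<phi>)"
      by (simp add: algebra_simps)
    also have "norm \<dots> \<le> \<bar>s - s'\<bar> * (4 * pi * M) + s0 * (4 * pi * norm (\<psi> - \<phi>))"
      using osc_le[OF that(1)] osc_diff[OF that(1,2)] that
      by (intro norm_triangle_le add_mono) (auto intro!: mult_mono)
    finally have 2: "norm (s *\<^sub>R ?o \<psi> - s' *\<^sub>R ?o \<phi>) \<le> 4 * pi * (M * \<bar>s - s'\<bar> + s0 * norm (\<psi> - \<phi>))"
      by (simp add: algebra_simps)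
    have "rho s \<psi> t - rho s' \<phi> t = (Q t (lam s \<psi>) - Q t (lam s' \<phi>)) + (s *\<^sub>R ?o \<psi> - s' *\<^sub>R ?o \<phi>)"
      by (simp add: rho_def)
    also have "norm \<dots> \<le> K * (M * \<bar>s - s'\<bar> + s0 * norm (\<psi> - \<phi>)) + 4 * pi * (M * \<bar>s - s'\<bar> + s0 * norm (\<psi> - \<phi>))"
      by (intro norm_triangle_le add_mono 1 2)
    finally show ?thesis by (simp add: distrib_right)
  qed
  define L where "L = M * (1 + c * M)"
  \<comment> \<open>One estimate serves twice: with \<open>s = s'\<close> it is the contraction property, and at the fixed points
     it yields the Lipschitz dependence on \<open>s\<close>.\<close>
  have F_diff: "norm (F s \<psi> - F s' \<phi>) \<le> L * \<bar>s - s'\<bar> + norm (\<psi> - \<phi>) / 2"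
    if "\<psi> \<in> S" "\<phi> \<in> S" "s \<in> {0..s0}" "s' \<in> {0..s0}" for \<psi> \<phi> s s'
  proof (rule norm_bound)
    fix t
    let ?D = "M * \<bar>s - s'\<bar> + s0 * norm (\<psi> - \<phi>)"
    let ?E = "\<bar>s - s'\<bar> + norm (rho s \<psi> t - rho s' \<phi> t) + norm (lam s \<psi> - lam s' \<phi>)"
    have "norm (apply_bcontfun (F s \<psi> - F s' \<phi>) t) \<le> M2 * ?E"
      unfolding minus_bcontfun.rep_eq F_apply[OF that(1,3)] F_apply[OF that(2,4)]
      by (rule M2) (use that s0M(3) rho_R lam_1 in auto)
    also have "\<dots> \<le> M * ?E"
      using M by (intro mult_right_mono) auto
    also have "\<dots> \<le> M * (\<bar>s - s'\<bar> + (K + 4 * pi) * ?D + ?D)"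
      using M by (intro mult_left_mono add_mono rho_diff lam_diff that order_refl) auto
    also have "\<dots> = L * \<bar>s - s'\<bar> + (M * c * s0) * norm (\<psi> - \<phi>)"
      by (simp add: L_def c_def algebra_simps)
    finally show "norm (apply_bcontfun (F s \<psi> - F s' \<phi>) t) \<le> L * \<bar>s - s'\<bar> + norm (\<psi> - \<phi>) / 2"
      by (simp add: s0(2))
  qed
  have "\<exists>\<psi>\<in>S. F s \<psi> = \<psi>" if s: "s \<in> {0..s0}" for s
    using Banach_fix[OF S_complete S_ne, of "1/2" "F s"] F_S[OF _ s] F_diff[OF _ _ s s]
    by (auto simp: dist_norm)
  then obtain \<psi> where \<psi>: "\<And>s. s \<in> {0..s0} \<Longrightarrow> \<psi> s \<in> S" "\<And>s. s \<in> {0..s0} \<Longrightarrow> F s (\<psi> s) = \<psi> s"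
    by metis
  have \<psi>_diff: "norm (\<psi> s - \<psi> s') \<le> 2 * L * \<bar>s - s'\<bar>" if "s \<in> {0..s0}" "s' \<in> {0..s0}" for s s'
    using F_diff[OF \<psi>(1) \<psi>(1) that, OF that]
    unfolding \<psi>(2)[OF that(1)] \<psi>(2)[OF that(2)] by linarith
  define E where "E = M + 2 * L"
  have L: "L \<ge> 0" using M c by (simp add: L_def)
  have E: "M * \<bar>s - s'\<bar> + s0 * norm (\<psi> s - \<psi> s') \<le> E * \<bar>s - s'\<bar>"
    if "s \<in> {0..s0}" "s' \<in> {0..s0}" for s s'
  proof -
    have "s0 * norm (\<psi> s - \<psi> s') \<le> 1 * (2 * L * \<bar>s - s'\<bar>)"
      using \<psi>_diff[OF that] s0M s0 by (intro mult_mono) auto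
    then show ?thesis by (simp add: E_def algebra_simps)
  qed
  define C where "C = R + M + c * E"
  have C: "C \<ge> R" "C \<ge> M" "C \<ge> (K + 4 * pi) * E" "C \<ge> E"
  proof -
    have "E \<ge> 0" "R \<ge> 0" using M L K by (auto simp: E_def R_def)
    then show "C \<ge> R" "C \<ge> M" "C \<ge> (K + 4 * pi) * E" "C \<ge> E"
      using M K by (auto simp: C_def c_def algebra_simps)
  qed
  show thesis
  proof (rule that[of s0 "\<lambda>s. rho s (\<psi> s)" "\<lambda>s. lam s (\<psi> s)" C])
    show "0 < s0" "s0 \<le> 1" by (fact s0 s0M)+
    fix s t assume s: "s \<in> {0..s0}"
    have "apply_bcontfun (\<psi> s) t = \<Psi> s t (rho s (\<psi> s) t) (lam s (\<psi> s))"
      using F_apply[OF \<psi>(1)[OF s] s, of t] by (simp add: \<psi>(2)[OF s])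
    then show "((rho s (\<psi> s)) has_vector_derivative lam s (\<psi> s) + Q' t (lam s (\<psi> s)) +
        s *\<^sub>R \<Psi> s t (rho s (\<psi> s) t) (lam s (\<psi> s))) (at t)"
      using rho_deriv[of s "\<psi> s" t] by (simp add: lam_def algebra_simps)
    show "rho s (\<psi> s) (t + 2 * pi) = rho s (\<psi> s) t" by (rule rho_per[OF \<psi>(1)[OF s]])
    show "rho s (\<psi> s) 0 = 0" by (simp add: rho_def Q0 oscillation_0)
    show "norm (rho s (\<psi> s) t) \<le> C" using rho_R[OF \<psi>(1)[OF s] s] C(1) order_trans by blast
    show "norm (lam s (\<psi> s)) \<le> C * s"
      using lam_s[OF \<psi>(1)[OF s] s] mult_right_mono[OF C(2), of s] s by simp
    fix s' assume s': "s' \<in> {0..s0}"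
    have 1: "norm (rho s (\<psi> s) t - rho s' (\<psi> s') t) \<le> (K + 4 * pi) * (E * \<bar>s - s'\<bar>)"
      using rho_diff[OF \<psi>(1)[OF s] \<psi>(1)[OF s'] s s', of t] mult_left_mono[OF E[OF s s'], of "K + 4 * pi"] K
      by simp
    also have "\<dots> \<le> C * \<bar>s - s'\<bar>"
      using mult_right_mono[OF C(3), of "\<bar>s - s'\<bar>"] by (simp add: mult_ac)
    finally show "norm (rho s (\<psi> s) t - rho s' (\<psi> s') t) \<le> C * \<bar>s - s'\<bar>" .
    have "norm (lam s (\<psi> s) - lam s' (\<psi> s')) \<le> E * \<bar>s - s'\<bar>"
      using lam_diff[OF \<psi>(1)[OF s] \<psi>(1)[OF s'] s s'] E[OF s s'] by linarith
    also have "\<dots> \<le> C * \<bar>s - s'\<bar>"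
      by (intro mult_right_mono C) simp
    finally show "norm (lam s (\<psi> s) - lam s' (\<psi> s')) \<le> C * \<bar>s - s'\<bar>" .
  qed
qed

section \<open>Bounded Lipschitz functions\<close>

text \<open>
  On bounded sets this class contains the bounded linear functions and is closed under sums and
  products, which are the operations that build the perturbation \<open>\<Psi>\<close>. The bound is part of the
  definition because the product rule needs it.
\<close>

definition bounded_lipschitz_on ::
  "'a::metric_space set \<Rightarrow> ('a \<Rightarrow> 'b::real_normed_vector) \<Rightarrow> bool" where
  "bounded_lipschitz_on D f \<longleftrightarrow>
     (\<exists>M. (\<forall>x\<in>D. norm (f x) \<le> M) \<and> (\<forall>x\<in>D. \<forall>y\<in>D. norm (f x - f y) \<le> M * dist x y))"

lemma bounded_lipschitz_onI:
  assumes "\<And>x. x \<in> D \<Longrightarrow> norm (f x) \<le> M1" "\<And>x y. x \<in> D \<Longrightarrow> y \<in> D \<Longrightarrow> norm (f x - f y) \<le> M2 * dist x y"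
  shows "bounded_lipschitz_on D f"
  unfolding bounded_lipschitz_on_def
proof (intro exI[of _ "max M1 M2"] conjI ballI)
  fix x y assume "x \<in> D" "y \<in> D"
  then show "norm (f x - f y) \<le> max M1 M2 * dist x y"
    using assms(2)[of x y] mult_right_mono[of M2 "max M1 M2" "dist x y"] by simp
qed (use assms(1) in force)

lemma bounded_lipschitz_onE:
  assumes "bounded_lipschitz_on D f"
  obtains M where "M \<ge> 0" "\<And>x. x \<in> D \<Longrightarrow> norm (f x) \<le> M"
    "\<And>x y. x \<in> D \<Longrightarrow> y \<in> D \<Longrightarrow> norm (f x - f y) \<le> M * dist x y"
proof -
  obtain M where M: "\<And>x. x \<in> D \<Longrightarrow> norm (f x) \<le> M"
    "\<And>x y. x \<in> D \<Longrightarrow> y \<in> D \<Longrightarrow> norm (f x - f y) \<le> M * dist x y"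
    using assms by (auto simp: bounded_lipschitz_on_def)
  show thesis
  proof (rule that[of "max 0 M"])
    fix x y assume "x \<in> D" "y \<in> D"
    then show "norm (f x - f y) \<le> max 0 M * dist x y"
      using M(2)[of x y] mult_right_mono[of M "max 0 M" "dist x y"] by simp
  qed (use M(1) in force)+
qed

lemma bounded_lipschitz_on_const: "bounded_lipschitz_on D (\<lambda>x. c)"
  by (rule bounded_lipschitz_onI[where ?M1.0="norm c" and ?M2.0=0]) auto

lemma bounded_lipschitz_on_ident:
  "bounded D \<Longrightarrow> bounded_lipschitz_on D (\<lambda>x::'a::real_normed_vector. x)"
  by (metis bounded_iff bounded_lipschitz_onI dist_norm mult_1 order_refl)

lemma bounded_lipschitz_on_bounded_linear:
  assumes "bounded_linear h" "bounded_lipschitz_on D f"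
  shows "bounded_lipschitz_on D (\<lambda>x. h (f x))"
proof -
  interpret bounded_linear h by fact
  obtain K where K: "K > 0" "\<And>x. norm (h x) \<le> norm x * K" using pos_bounded by blast
  obtain M where M: "\<And>x. x \<in> D \<Longrightarrow> norm (f x) \<le> M"
    "\<And>x y. x \<in> D \<Longrightarrow> y \<in> D \<Longrightarrow> norm (f x - f y) \<le> M * dist x y"
    using bounded_lipschitz_onE[OF assms(2)] by metis
  show ?thesis
  proof (rule bounded_lipschitz_onI)
    show "norm (h (f x)) \<le> M * K" if "x \<in> D" for x
      using K(2)[of "f x"] mult_right_mono[OF M(1)[OF that], of K] K(1) by linarith
    show "norm (h (f x) - h (f y)) \<le> (M * K) * dist x y" if "x \<in> D" "y \<in> D" for x y
    proof -
      have "norm (h (f x) - h (f y)) \<le> norm (f x - f y) * K"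
        using K(2)[of "f x - f y"] by (simp add: diff)
      also have "\<dots> \<le> M * dist x y * K"
        using M(2)[OF that] K(1) by (intro mult_right_mono) auto
      finally show ?thesis by (simp add: mult_ac)
    qed
  qed
qed

lemma bounded_lipschitz_on_add:
  assumes "bounded_lipschitz_on D f" "bounded_lipschitz_on D g"
  shows "bounded_lipschitz_on D (\<lambda>x. f x + g x)"
proof -
  obtain M where M: "\<And>x. x \<in> D \<Longrightarrow> norm (f x) \<le> M"
    "\<And>x y. x \<in> D \<Longrightarrow> y \<in> D \<Longrightarrow> norm (f x - f y) \<le> M * dist x y"
    using bounded_lipschitz_onE[OF assms(1)] by metis
  obtain N where N: "\<And>x. x \<in> D \<Longrightarrow> norm (g x) \<le> N"
    "\<And>x y. x \<in> D \<Longrightarrow> y \<in> D \<Longrightarrow> norm (g x - g y) \<le> N * dist x y"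
    using bounded_lipschitz_onE[OF assms(2)] by metis
  show ?thesis
  proof (rule bounded_lipschitz_onI)
    show "norm (f x + g x) \<le> M + N" if "x \<in> D" for x
      using M(1) N(1) that by (intro norm_triangle_le add_mono)
    show "norm (f x + g x - (f y + g y)) \<le> (M + N) * dist x y" if "x \<in> D" "y \<in> D" for x y
      using norm_diff_triangle_ineq[of "f x" "g x" "f y" "g y"] M(2)[OF that] N(2)[OF that]
      by (simp add: distrib_right)
  qed
qed

lemma bounded_lipschitz_on_mult:
  fixes f g :: "'a::metric_space \<Rightarrow> 'b::real_normed_algebra"
  assumes "bounded_lipschitz_on D f" "bounded_lipschitz_on D g"
  shows "bounded_lipschitz_on D (\<lambda>x. f x * g x)"
proof -
  obtain M where M: "M \<ge> 0" "\<And>x. x \<in> D \<Longrightarrow> norm (f x) \<le> M"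
    "\<And>x y. x \<in> D \<Longrightarrow> y \<in> D \<Longrightarrow> norm (f x - f y) \<le> M * dist x y"
    using bounded_lipschitz_onE[OF assms(1)] by metis
  obtain N where N: "N \<ge> 0" "\<And>x. x \<in> D \<Longrightarrow> norm (g x) \<le> N"
    "\<And>x y. x \<in> D \<Longrightarrow> y \<in> D \<Longrightarrow> norm (g x - g y) \<le> N * dist x y"
    using bounded_lipschitz_onE[OF assms(2)] by metis
  show ?thesis
  proof (rule bounded_lipschitz_onI)
    show "norm (f x * g x) \<le> M * N" if "x \<in> D" for x
      using M(1) M(2)[OF that] N(2)[OF that] by (intro order_trans[OF norm_mult_ineq] mult_mono) auto
    show "norm (f x * g x - f y * g y) \<le> (M * N + M * N) * dist x y" if "x \<in> D" "y \<in> D" for x y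
    proof -
      have "f x * g x - f y * g y = f x * (g x - g y) + (f x - f y) * g y"
        by (simp add: algebra_simps)
      also have "norm \<dots> \<le> M * (N * dist x y) + (M * dist x y) * N"
        using that M N by (intro norm_triangle_le add_mono order_trans[OF norm_mult_ineq] mult_mono) auto
      finally show ?thesis by (simp add: algebra_simps)
    qed
  qed
qed

lemma bounded_lipschitz_on_diff:
  "bounded_lipschitz_on D f \<Longrightarrow> bounded_lipschitz_on D g \<Longrightarrow> bounded_lipschitz_on D (\<lambda>x. f x - g x)"
  using bounded_lipschitz_on_add[of D f "\<lambda>x. - g x"]
    bounded_lipschitz_on_bounded_linear[OF bounded_linear_minus[OF bounded_linear_ident], of D g]
  by simp

lemma bounded_lipschitz_on_power:
  fixes f :: "'a::metric_space \<Rightarrow> 'b::real_normed_algebra_1"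
  shows "bounded_lipschitz_on D f \<Longrightarrow> bounded_lipschitz_on D (\<lambda>x. f x ^ n)"
  by (induction n) (auto intro: bounded_lipschitz_on_const bounded_lipschitz_on_mult)

lemma bounded_lipschitz_on_poly:
  fixes f :: "'a::metric_space \<Rightarrow> real"
  assumes "bounded_lipschitz_on D f"
  shows "bounded_lipschitz_on D (\<lambda>x. poly p (f x))"
  by (induction p) (simp_all add: bounded_lipschitz_on_const bounded_lipschitz_on_add bounded_lipschitz_on_mult assms)

lemmas bounded_lipschitz_intros =
  bounded_lipschitz_on_const bounded_lipschitz_on_add bounded_lipschitz_on_diff
  bounded_lipschitz_on_mult bounded_lipschitz_on_power bounded_lipschitz_on_poly
  bounded_lipschitz_on_bounded_linear[OF bounded_linear_Re]
  bounded_lipschitz_on_bounded_linear[OF bounded_linear_Im]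
  bounded_lipschitz_on_bounded_linear[OF bounded_linear_of_real]
  bounded_lipschitz_on_bounded_linear[OF bounded_linear_cnj]

text \<open>
  Each orbit is continuous in time and the family is Lipschitz in the amplitude, uniformly in time;
  together this gives joint continuity.
\<close>

lemma continuous_on_Times_lipschitz:
  fixes f :: "'a::metric_space \<Rightarrow> 'b::metric_space \<Rightarrow> 'c::metric_space"
  assumes "\<And>s. s \<in> S \<Longrightarrow> continuous_on T (f s)"
    and "\<And>s s' t. s \<in> S \<Longrightarrow> s' \<in> S \<Longrightarrow> t \<in> T \<Longrightarrow> dist (f s t) (f s' t) \<le> C * dist s s'"
  shows "continuous_on (S \<times> T) (\<lambda>(s, t). f s t)"
  unfolding continuous_on_iff
proof (safe, simp)
  fix a b and e :: real
  assume H: "a \<in> S" "b \<in> T" "0 < e"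
  obtain d where d: "d > 0" "\<And>t. t \<in> T \<Longrightarrow> dist t b < d \<Longrightarrow> dist (f a t) (f a b) < e / 2"
    using assms(1)[OF H(1)] H(2,3) unfolding continuous_on_iff by (metis half_gt_zero)
  define K where "K = \<bar>C\<bar> + 1"
  have K: "K > 0" "C \<le> K" by (auto simp: K_def)
  show "\<exists>d>0. \<forall>x\<in>S. \<forall>y\<in>T. dist (x, y) (a, b) < d \<longrightarrow> dist (f x y) (f a b) < e"
  proof (intro exI[of _ "min d (e / (2 * K))"] conjI ballI impI)
    fix s t assume st: "s \<in> S" "t \<in> T" "dist (s, t) (a, b) < min d (e / (2 * K))"
    have "dist t b < d" "dist s a < e / (2 * K)"
      using dist_fst_le[of "(s, t)" "(a, b)"] dist_snd_le[of "(s, t)" "(a, b)"] st(3) by auto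
    then have "dist (f a t) (f a b) < e / 2" "K * dist s a < e / 2"
      using d st(2) K by (auto simp: field_simps)
    moreover have "dist (f s t) (f a t) \<le> K * dist s a"
      using assms(2)[OF st(1) H(1) st(2)] mult_right_mono[OF K(2), of "dist s a"] by simp
    ultimately show "dist (f s t) (f a b) < e"
      using dist_triangle[of "f s t" "f a b" "f a t"] by linarith
  qed (use H d K in auto)
qed

section \<open>The rescaled system near a weak focus\<close>

text \<open>
  The setting for the periodic orbits of \<open>\<epsilon> x' = y + x (x - 1)\<close>, \<open>y' = - g x + r\<close>. The linear
  coefficient \<open>g1\<close> is positive, so that the linear part at the bifurcation is a rotation.
\<close>

locale focus_expansion =
  fixes g :: "real \<Rightarrow> real" and \<epsilon> g1 g2 :: real and q :: "real poly"
  assumes eps_pos: "\<epsilon> > 0" and g1_pos: "g1 > 0"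
    and expansion: "\<And>h. g (1/2 + h) = g (1/2) + g1 * h + g2 * h ^ 2 + h ^ 3 * poly q h"
begin

definition \<omega> :: real where "\<omega> = sqrt (g1 / \<epsilon>)"

text \<open>
  The complex coefficient of the quadratic part of the rescaled field: its real part comes from
  \<open>x (x - 1)\<close> and its imaginary part from the quadratic coefficient of \<open>g\<close>.
\<close>

definition k :: complex where "k = Complex (1 / (\<epsilon> * \<omega>)) (g2 / g1)"

text \<open>
  The map \<open>l \<mapsto> (\<beta> l, \<sigma> l)\<close> inverts \<open>\<i> \<sigma> + k \<beta> = l\<close>, the mean of the leading part of the equation. Here
  \<open>1/2 + s * \<beta> l\<close> is the first coordinate of the equilibrium, and \<open>\<sigma>\<close> corrects the period.
\<close>

definition \<beta> :: "complex \<Rightarrow> real" where "\<beta> l = \<epsilon> * \<omega> * Re l"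

definition \<sigma> :: "complex \<Rightarrow> real" where "\<sigma> l = Im l - \<beta> l * (g2 / g1)"

text \<open>
  What the cubic remainder of \<open>g\<close> contributes to \<open>g (1/2 + s (b + X)) - g (1/2 + s b)\<close>, divided by
  \<open>s ^ 3\<close>.
\<close>

definition rest :: "real \<Rightarrow> real \<Rightarrow> real \<Rightarrow> real" where
  "rest s b X = (b + X) ^ 3 * poly q (s * (b + X)) - b ^ 3 * poly q (s * b)"

text \<open>
  The rescaled system reads \<open>z' = (1 + s \<sigma>) (\<i> z + s * field s b (Re z))\<close>; see \<open>rescaled_solution\<close> for
  the way back to the original variables.
\<close>

definition field :: "real \<Rightarrow> real \<Rightarrow> real \<Rightarrow> complex" where
  "field s b X = k * of_real (2 * b * X + X ^ 2) + \<i> * of_real (s * rest s b X / g1)"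

text \<open>
  The terms that carry a factor \<open>s\<close> when \<open>z = w * (1 + s r)\<close>, with \<open>w = cis t\<close>, is inserted into the
  rescaled system. Keeping \<open>w\<close> as an argument makes this a real polynomial in its arguments, hence
  Lipschitz on bounded sets.
\<close>

definition remainder :: "real \<Rightarrow> complex \<Rightarrow> complex \<Rightarrow> complex \<Rightarrow> complex" where
  "remainder s w r l =
     (let b = \<beta> l; X0 = Re w; X1 = Re (w * r); X = X0 + s * X1
      in \<i> * of_real (\<sigma> l) * r + of_real (\<sigma> l) * cnj w * field s b X
         + cnj w * (k * of_real (2 * b * X1 + 2 * X0 * X1 + s * X1 ^ 2) + \<i> * of_real (rest s b X / g1)))"

text \<open>
  The antiderivative of the mean-free part of the leading order, in closed form. That it is periodic expresses that \<open>cos t ^ 2 * cis (- t)\<close> has mean zero: the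
  quadratic terms do not shift the parameters to leading order.
\<close>

definition primitive :: "real \<Rightarrow> complex \<Rightarrow> complex" where
  "primitive t l =
     k * ((- \<i> * cis t + 2 * \<i> * cnj (cis t) + \<i> / 3 * cnj (cis t) ^ 3) / 4 - \<i> / 3)
     + k * of_real (\<beta> l) * (\<i> / 2) * (cnj (cis t) ^ 2 - 1)"

definition integrand :: "real \<Rightarrow> complex \<Rightarrow> complex" where
  "integrand t l = k * of_real (\<beta> l) * cnj (cis t) ^ 2 + k * cnj (cis t) * of_real (cos t) ^ 2"

lemma omega: "\<omega> > 0" "\<epsilon> * \<omega> ^ 2 = g1"
  using eps_pos g1_pos by (auto simp: \<omega>_def real_sqrt_pow2)

lemma average_identity: "\<i> * of_real (\<sigma> l) + k * of_real (\<beta> l) = l"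
  using omega eps_pos g1_pos by (auto simp: complex_eq_iff \<sigma>_def k_def \<beta>_def)

lemma cis_cnj_cis: "cis t * cnj (cis t) = 1"
  by (simp add: cis_cnj cis_mult)

lemma cos_eq_cis: "complex_of_real (cos t) = (cis t + cnj (cis t)) / 2"
  by (simp add: complex_eq_iff)

lemma cis_has_vector_derivative: "(cis has_vector_derivative \<i> * cis t) (at t)"
proof -
  have "((\<lambda>t. exp (t *\<^sub>R \<i>)) has_vector_derivative \<i> * exp (t *\<^sub>R \<i>)) (at t)"
    by (rule exp_scaleR_has_vector_derivative_left)
  moreover have "cis = (\<lambda>t. exp (t *\<^sub>R \<i>))"
    by (simp add: fun_eq_iff cis_conv_exp scaleR_conv_of_real mult.commute)
  ultimately show ?thesis by metis
qed

lemma primitive_derivative: "((\<lambda>t. primitive t l) has_vector_derivative integrand t l) (at t)"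
proof -
  define w v where "w = cis t" and "v = cnj (cis t)"
  have wv: "w * v = 1" by (simp add: w_def v_def cis_cnj_cis)
  have v: "((\<lambda>t. cnj (cis t)) has_vector_derivative - \<i> * v) (at t)"
    using bounded_linear.has_vector_derivative[OF bounded_linear_cnj cis_has_vector_derivative, of t]
    by (simp add: v_def)
  have v2: "((\<lambda>t. cnj (cis t) ^ 2) has_vector_derivative - 2 * \<i> * v ^ 2) (at t)"
    using has_vector_derivative_mult[OF v v] by (simp add: power2_eq_square v_def algebra_simps)
  have v3: "((\<lambda>t. cnj (cis t) ^ 3) has_vector_derivative - 3 * \<i> * v ^ 3) (at t)"
    using has_vector_derivative_mult[OF v v2] by (simp add: power2_eq_square power3_eq_cube v_def algebra_simps)
  have "((\<lambda>t. (- \<i> * cis t + 2 * \<i> * cnj (cis t) + \<i> / 3 * cnj (cis t) ^ 3) / 4 - \<i> / 3) has_vector_derivative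
      (- \<i> * (\<i> * cis t) + 2 * \<i> * (- \<i> * v) + \<i> / 3 * (- 3 * \<i> * v ^ 3)) / 4 - 0) (at t)"
    by (intro has_vector_derivative_diff has_vector_derivative_divide has_vector_derivative_add
        has_vector_derivative_mult_right has_vector_derivative_const cis_has_vector_derivative v v3)
  moreover have "((\<lambda>t. cnj (cis t) ^ 2 - 1) has_vector_derivative - 2 * \<i> * v ^ 2 - 0) (at t)"
    by (intro has_vector_derivative_diff has_vector_derivative_const v2)
  ultimately have "((\<lambda>t. primitive t l) has_vector_derivative
      k * ((- \<i> * (\<i> * cis t) + 2 * \<i> * (- \<i> * v) + \<i> / 3 * (- 3 * \<i> * v ^ 3)) / 4 - 0)
      + k * of_real (\<beta> l) * (\<i> / 2) * (- 2 * \<i> * v ^ 2 - 0)) (at t)"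
    unfolding primitive_def by (intro has_vector_derivative_add has_vector_derivative_mult_right)
  moreover have "k * ((- \<i> * (\<i> * cis t) + 2 * \<i> * (- \<i> * v) + \<i> / 3 * (- 3 * \<i> * v ^ 3)) / 4 - 0)
      + k * of_real (\<beta> l) * (\<i> / 2) * (- 2 * \<i> * v ^ 2 - 0) = integrand t l"
  proof -
    have "v * ((w + v) / 2) ^ 2 = (w * (w * v) + 2 * (w * v) * v + v ^ 3) / 4"
      by (simp add: field_simps power2_eq_square power3_eq_cube)
    then have "v * ((w + v) / 2) ^ 2 = (w + 2 * v + v ^ 3) / 4"
      by (simp only: wv mult_1_right)
    moreover have "integrand t l = k * of_real (\<beta> l) * v ^ 2 + k * (v * ((w + v) / 2) ^ 2)"
      unfolding integrand_def cos_eq_cis v_def w_def by (simp only: mult.assoc)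
    ultimately show ?thesis
      by (simp add: w_def field_simps)
  qed
  ultimately show ?thesis by simp
qed

lemma primitive_periodic: "primitive (t + 2 * pi) l = primitive t l"
  by (simp add: primitive_def cis.ctr)

lemma primitive_0: "primitive 0 l = 0"
  by (simp add: primitive_def)

lemma beta_sigma_bound: obtains B where "B \<ge> 1" "\<And>l. \<bar>\<beta> l\<bar> \<le> B * norm l" "\<And>l. \<bar>\<sigma> l\<bar> \<le> B * norm l"
proof -
  let ?B = "1 + \<epsilon> * \<omega> + \<epsilon> * \<omega> * \<bar>g2 / g1\<bar>"
  have p: "\<epsilon> * \<omega> > 0" using eps_pos omega by simp
  have b: "\<bar>\<beta> l\<bar> \<le> \<epsilon> * \<omega> * norm l" for l
    using abs_Re_le_cmod[of l] p eps_pos omega by (simp add: \<beta>_def abs_mult)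
  have "\<bar>\<beta> l\<bar> \<le> ?B * norm l" for l
    using b[of l] p mult_right_mono[of "\<epsilon> * \<omega>" ?B "norm l"] by auto
  moreover have "\<bar>\<sigma> l\<bar> \<le> ?B * norm l" for l
  proof -
    have "\<bar>\<sigma> l\<bar> \<le> \<bar>Im l\<bar> + \<bar>\<beta> l\<bar> * \<bar>g2 / g1\<bar>"
      unfolding \<sigma>_def by (metis abs_mult abs_triangle_ineq4)
    also have "\<dots> \<le> norm l + \<epsilon> * \<omega> * norm l * \<bar>g2 / g1\<bar>"
      by (intro add_mono abs_Im_le_cmod mult_right_mono b) auto
    also have "\<dots> \<le> \<dots> + \<epsilon> * \<omega> * norm l" using p by simp
    finally show ?thesis by (simp add: algebra_simps)
  qed
  ultimately show thesis using that[of ?B] p by simp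
qed

lemma beta_diff: "\<beta> l - \<beta> m = \<beta> (l - m)" by (simp add: \<beta>_def algebra_simps)

lemma bounded_lipschitz_remainder:
  "bounded_lipschitz_on ({0..1} \<times> cball 0 1 \<times> cball 0 R \<times> cball 0 1)
     (\<lambda>(s, w, r, l). remainder s w r l)" (is "bounded_lipschitz_on ?D _")
proof -
  have "bounded ?D" by (intro bounded_Times) auto
  note id = bounded_lipschitz_on_ident[OF this]
  have "bounded_lipschitz_on ?D (\<lambda>p. fst p)" "bounded_lipschitz_on ?D (\<lambda>p. fst (snd p))"
    "bounded_lipschitz_on ?D (\<lambda>p. fst (snd (snd p)))" "bounded_lipschitz_on ?D (\<lambda>p. snd (snd (snd p)))"
    by (intro bounded_lipschitz_on_bounded_linear[OF bounded_linear_fst]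
        bounded_lipschitz_on_bounded_linear[OF bounded_linear_snd] id)+
  then show ?thesis
    unfolding remainder_def field_def rest_def \<sigma>_def \<beta>_def split_beta Let_def divide_inverse
    by (intro bounded_lipschitz_intros)
qed

lemma norm_primitive_0: "norm (primitive t 0) \<le> 2 * norm k"
proof -
  have "norm (- \<i> * cis t + 2 * \<i> * cnj (cis t) + \<i> / 3 * cnj (cis t) ^ 3) \<le> 1 + 2 + 1 / 3"
    by (intro norm_triangle_le add_mono) (simp_all add: norm_mult norm_divide norm_power)
  then have "norm ((- \<i> * cis t + 2 * \<i> * cnj (cis t) + \<i> / 3 * cnj (cis t) ^ 3) / 4 - \<i> / 3) \<le> (1 + 2 + 1 / 3) / 4 + 1 / 3"
    by (intro order_trans[OF norm_triangle_ineq4] add_mono) (simp_all add: norm_divide)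
  from mult_left_mono[OF this, of "norm k"]
  have "norm (primitive t 0) \<le> norm k * ((1 + 2 + 1 / 3) / 4 + 1 / 3)"
    by (simp add: primitive_def \<beta>_def norm_mult)
  also have "\<dots> \<le> norm k * 2"
    by (intro mult_left_mono) auto
  finally show ?thesis by (simp add: mult.commute)
qed

lemma norm_primitive_diff:
  assumes "\<And>l. \<bar>\<beta> l\<bar> \<le> B * norm l"
  shows "norm (primitive t l - primitive t m) \<le> norm k * B * norm (l - m)"
proof -
  have "primitive t l - primitive t m = k * of_real (\<beta> l - \<beta> m) * (\<i> / 2) * (cnj (cis t) ^ 2 - 1)"
    by (simp add: primitive_def algebra_simps)
  moreover have "norm (cnj (cis t) ^ 2 - 1) \<le> 2"
    using norm_triangle_ineq4[of "cnj (cis t) ^ 2" 1] by (simp add: norm_power)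
  moreover have "norm (k * of_real (\<beta> l - \<beta> m) * (\<i> / 2) * u) = norm k * \<bar>\<beta> (l - m)\<bar> * (1 / 2) * norm u" for u
    unfolding beta_diff by (simp add: norm_mult norm_divide)
  ultimately have "norm (primitive t l - primitive t m) \<le> norm k * \<bar>\<beta> (l - m)\<bar> * (1 / 2) * 2"
    by (metis mult_left_mono mult_nonneg_nonneg norm_ge_zero abs_ge_zero zero_le_divide_1_iff zero_le_numeral)
  also have "\<dots> \<le> norm k * (B * norm (l - m))"
    using assms[of "l - m"] by (auto intro!: mult_left_mono)
  finally show ?thesis by (simp add: mult.assoc)
qed

text \<open>
  The terms without the factor \<open>s\<close> are \<open>\<i> \<sigma> + cnj w * k * (2 \<beta> cos t + (cos t) ^ 2)\<close>. Since
  \<open>2 * cnj w * cos t = 1 + cnj w ^ 2\<close>, their constant part is \<open>\<i> \<sigma> + k \<beta> = l\<close> and the rest is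
  \<open>integrand t l\<close>.
\<close>

lemma rotating_frame_identity:
  assumes "w = cis t" "X = Re (w * (1 + of_real s * r))"
  shows "l + integrand t l + s *\<^sub>R remainder s w r l =
    \<i> * of_real (\<sigma> l) * (1 + of_real s * r) + of_real (1 + s * \<sigma> l) * cnj w * field s (\<beta> l) X"
proof -
  define b where "b = \<beta> l"
  define v where "v = cnj w"
  define X0 X1 where "X0 = Re w" and "X1 = Re (w * r)"
  have X: "X = X0 + s * X1"
    by (simp add: assms(2) X0_def X1_def algebra_simps)
  have X0: "X0 = cos t" "of_real X0 = (w + v) / 2"
    using cos_eq_cis[of t] by (simp_all add: assms(1) X0_def v_def)
  have "v * (w + v) = w * v + v ^ 2"
    by (simp add: power2_eq_square algebra_simps)
  also have "w * v = 1" by (simp add: assms(1) v_def cis_cnj_cis)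
  finally have v: "v * (w + v) = 1 + v ^ 2" .
  have "l + integrand t l = \<i> * of_real (\<sigma> l) + k * of_real b * (1 + v ^ 2) + k * v * of_real X0 ^ 2"
    using average_identity[of l] by (simp add: X0(1) integrand_def b_def v_def assms(1) algebra_simps)
  also have "\<dots> = \<i> * of_real (\<sigma> l) + v * (k * of_real (2 * b * X0 + X0 ^ 2))"
    by (simp add: v[symmetric] X0(2) algebra_simps)
  finally have 1: "l + integrand t l = \<i> * of_real (\<sigma> l) + v * (k * of_real (2 * b * X0 + X0 ^ 2))" .
  have 2: "field s b X = k * of_real (2 * b * X0 + X0 ^ 2) + of_real s * (k * of_real (2 * b * X1 + 2 * X0 * X1 + s * X1 ^ 2) + \<i> * of_real (rest s b X / g1))"
    unfolding field_def by (simp add: X power2_eq_square algebra_simps)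
  show ?thesis
    unfolding 1 remainder_def Let_def b_def[symmetric] X0_def[symmetric] X1_def[symmetric] X[symmetric] v_def[symmetric]
    using arg_cong[OF 2, of "\<lambda>u. v * u"]
    by (simp add: scaleR_conv_of_real algebra_simps)
qed

lemma rotating_frame:
  fixes r :: "real \<Rightarrow> complex"
  assumes "(r has_vector_derivative l + integrand t l + s *\<^sub>R remainder s (cis t) (r t) l) (at t)"
  defines "z \<equiv> \<lambda>t. cis t * (1 + of_real s * r t)"
  shows "(z has_vector_derivative (1 + s * \<sigma> l) *\<^sub>R (\<i> * z t + s *\<^sub>R field s (\<beta> l) (Re (z t)))) (at t)"
proof -
  let ?F = "field s (\<beta> l) (Re (z t))"
  have id: "l + integrand t l + s *\<^sub>R remainder s (cis t) (r t) l =
      \<i> * of_real (\<sigma> l) * (1 + of_real s * r t) + of_real (1 + s * \<sigma> l) * cnj (cis t) * ?F"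
    by (rule rotating_frame_identity) (simp_all add: z_def)
  have "(z has_vector_derivative cis t * (0 + of_real s * (l + integrand t l + s *\<^sub>R remainder s (cis t) (r t) l))
      + (\<i> * cis t) * (1 + of_real s * r t)) (at t)"
    unfolding z_def by (intro has_vector_derivative_mult has_vector_derivative_add has_vector_derivative_const
      has_vector_derivative_mult_right cis_has_vector_derivative assms(1))
  moreover have "cis t * (0 + of_real s * (\<i> * of_real (\<sigma> l) * (1 + of_real s * r t) + of_real (1 + s * \<sigma> l) * cnj (cis t) * ?F))
      + (\<i> * cis t) * (1 + of_real s * r t) =
      of_real (1 + s * \<sigma> l) * (\<i> * z t) + of_real s * of_real (1 + s * \<sigma> l) * (cis t * cnj (cis t)) * ?F"
    by (simp add: z_def algebra_simps)
  moreover have "\<dots> = (1 + s * \<sigma> l) *\<^sub>R (\<i> * z t + s *\<^sub>R ?F)"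
    by (simp only: cis_cnj_cis scaleR_conv_of_real) (simp add: algebra_simps)
  ultimately show ?thesis
    by (simp only: id)
qed

text \<open>
  Undoing the scaling. The second coordinate \<open>1/4 - (s b) ^ 2\<close> is that of the equilibrium whose first
  coordinate is \<open>1/2 + s b\<close>, and \<open>\<epsilon> * \<omega> ^ 2 = g1\<close> balances the linear terms.
\<close>

lemma rescaled_solution:
  fixes z :: "real \<Rightarrow> complex"
  assumes z: "\<And>t. (z has_vector_derivative m *\<^sub>R (\<i> * z t + s *\<^sub>R field s b (Re (z t)))) (at t)"
    and m: "m \<noteq> 0"
  defines "x \<equiv> \<lambda>t. 1 / 2 + s * b + s * Re (z (\<omega> * t / m))"
    and "y \<equiv> \<lambda>t. 1 / 4 - (s * b) ^ 2 - s * \<epsilon> * \<omega> * Im (z (\<omega> * t / m))"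
  shows "(x has_real_derivative (y t + x t * (x t - 1)) / \<epsilon>) (at t)"
    and "(y has_real_derivative - g (x t) + g (1 / 2 + s * b)) (at t)"
proof -
  define T where "T = \<omega> * t / m"
  define X where "X = Re (z T)"
  define Y where "Y = - Im (z T)"
  have xt: "x t = 1 / 2 + s * b + s * X" and yt: "y t = 1 / 4 - (s * b) ^ 2 + s * \<epsilon> * \<omega> * Y"
    by (simp_all add: x_def y_def X_def Y_def T_def)
  have "((\<lambda>t. \<omega> * t / m) has_vector_derivative \<omega> / m) (at t)"
    unfolding has_real_derivative_iff_has_vector_derivative[symmetric]
    using m by (auto intro!: derivative_eq_intros)
  from vector_diff_chain_at[OF this z]
  have zt: "((\<lambda>t. z (\<omega> * t / m)) has_vector_derivative (\<omega> / m) *\<^sub>R m *\<^sub>R (\<i> * z T + s *\<^sub>R field s b X)) (at t)"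
    unfolding o_def T_def X_def .
  have dX: "((\<lambda>t. Re (z (\<omega> * t / m))) has_real_derivative \<omega> * (Y + s * (2 * b * X + X ^ 2) / (\<epsilon> * \<omega>))) (at t)"
    using bounded_linear.has_vector_derivative[OF bounded_linear_Re zt] m
    by (simp add: has_real_derivative_iff_has_vector_derivative Y_def X_def field_def k_def)
  have dY: "((\<lambda>t. Im (z (\<omega> * t / m))) has_real_derivative \<omega> * (X + s * (g2 * (2 * b * X + X ^ 2) + s * rest s b X) / g1)) (at t)"
  proof -
    have "Im (field s b X) = (g2 * (2 * b * X + X ^ 2) + s * rest s b X) / g1"
      by (simp add: field_def k_def add_divide_distrib)
    then show ?thesis
      using bounded_linear.has_vector_derivative[OF bounded_linear_Im zt] m
      by (simp add: has_real_derivative_iff_has_vector_derivative X_def)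
  qed
  have "(x has_real_derivative s * (\<omega> * (Y + s * (2 * b * X + X ^ 2) / (\<epsilon> * \<omega>)))) (at t)"
    using DERIV_add[OF DERIV_const[of "1 / 2 + s * b"] DERIV_cmult[OF dX, of s]]
    unfolding x_def by (simp only: add_0)
  moreover have "s * (\<omega> * (Y + s * (2 * b * X + X ^ 2) / (\<epsilon> * \<omega>))) = (y t + x t * (x t - 1)) / \<epsilon>"
    using eps_pos omega(1)
    by (simp add: xt yt field_simps power2_eq_square)
  ultimately show "(x has_real_derivative (y t + x t * (x t - 1)) / \<epsilon>) (at t)" by simp
  have dy: "(y has_real_derivative - (s * \<epsilon> * \<omega> * (\<omega> * (X + s * (g2 * (2 * b * X + X ^ 2) + s * rest s b X) / g1)))) (at t)"
    using DERIV_diff[OF DERIV_const[of "1 / 4 - (s * b) ^ 2"] DERIV_cmult[OF dY, of "s * \<epsilon> * \<omega>"]]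
    unfolding y_def by (simp only: diff_0)
  have "s * \<epsilon> * \<omega> * (\<omega> * (X + s * (g2 * (2 * b * X + X ^ 2) + s * rest s b X) / g1))
      = (\<epsilon> * \<omega> ^ 2) * (s * X + s ^ 2 * (g2 * (2 * b * X + X ^ 2) + s * rest s b X) / g1)"
    by (simp add: power2_eq_square algebra_simps)
  also have "\<dots> = g1 * (s * X) + s ^ 2 * (g2 * (2 * b * X + X ^ 2) + s * rest s b X)"
    using g1_pos by (simp add: omega(2) field_simps)
  also have "\<dots> = g (x t) - g (1 / 2 + s * b)"
  proof -
    have "x t = 1 / 2 + (s * (b + X))"
      by (simp add: xt algebra_simps)
    then show ?thesis
      by (simp only: expansion[of "s * (b + X)"] expansion[of "s * b"] rest_def)
         (simp add: power2_eq_square power3_eq_cube algebra_simps)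
  qed
  finally show "(y has_real_derivative - g (x t) + g (1 / 2 + s * b)) (at t)"
    using dy by simp
qed

lemma continuous_remainder:
  assumes "continuous_on UNIV r"
  shows "continuous_on UNIV (\<lambda>t. remainder s (cis t) (r t) l)"
proof -
  have cis: "continuous_on UNIV cis"
    using cis_has_vector_derivative by (meson continuous_at_imp_continuous_on has_vector_derivative_continuous)
  show ?thesis
    unfolding remainder_def field_def rest_def Let_def divide_inverse
    by (intro continuous_on_add continuous_on_diff continuous_on_mult continuous_on_power
        continuous_on_const continuous_on_of_real continuous_on_Re continuous_on_cnj
        continuous_on_poly cis assms)
qed

text \<open>
  The function \<open>b s\<close> is the displacement of the equilibrium from \<open>1/2\<close>, so the orbit of amplitude
  \<open>s\<close> belongs to the parameter value \<open>g (1/2 + b s)\<close>. It has period \<open>2 * pi * (1 + s \<sigma>) / \<omega>\<close>, and it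
  is not constant because \<open>Re z\<close> is \<open>1\<close> at time \<open>0\<close> and negative half a period later.
\<close>

lemma periodic_orbit_family:
  obtains s0 C b x y where "s0 > 0"
    "continuous_on {0<..<s0} b" "\<And>s. s \<in> {0<..<s0} \<Longrightarrow> \<bar>b s\<bar> \<le> C * s" "\<And>s. s \<in> {0<..<s0} \<Longrightarrow> \<bar>b s\<bar> < 1 / 2"
    "continuous_on ({0<..<s0} \<times> UNIV) (\<lambda>(s, t). x s t)" "continuous_on ({0<..<s0} \<times> UNIV) (\<lambda>(s, t). y s t)"
    "\<And>s t. s \<in> {0<..<s0} \<Longrightarrow> \<bar>x s t - 1 / 2\<bar> \<le> C * s" "\<And>s t. s \<in> {0<..<s0} \<Longrightarrow> \<bar>y s t - 1 / 4\<bar> \<le> C * s"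
    "\<And>s t. s \<in> {0<..<s0} \<Longrightarrow> ((x s) has_real_derivative (y s t + x s t * (x s t - 1)) / \<epsilon>) (at t)"
    "\<And>s t. s \<in> {0<..<s0} \<Longrightarrow> ((y s) has_real_derivative - g (x s t) + g (1 / 2 + b s)) (at t)"
    "\<And>s. s \<in> {0<..<s0} \<Longrightarrow> \<exists>T>0. \<forall>t. x s (t + T) = x s t \<and> y s (t + T) = y s t"
    "\<And>s. s \<in> {0<..<s0} \<Longrightarrow> \<exists>t. x s t \<noteq> x s 0"
proof -
  obtain B where B: "B \<ge> 1" "\<And>l. \<bar>\<beta> l\<bar> \<le> B * norm l" "\<And>l. \<bar>\<sigma> l\<bar> \<le> B * norm l"
    using beta_sigma_bound by metis
  define K where "K = norm k * (B + 2)"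
  have K: "norm k * B \<le> K" "2 * norm k \<le> K"
    using B by (auto simp: K_def algebra_simps)
  have rem_bl: "\<exists>M\<ge>0. (\<forall>s t r l. 0 \<le> s \<and> s \<le> 1 \<and> norm r \<le> R \<and> norm l \<le> 1 \<longrightarrow> norm (remainder s (cis t) r l) \<le> M) \<and>
      (\<forall>s s' t r r' l l'. 0 \<le> s \<and> s \<le> 1 \<and> norm r \<le> R \<and> norm l \<le> 1 \<and>
        0 \<le> s' \<and> s' \<le> 1 \<and> norm r' \<le> R \<and> norm l' \<le> 1 \<longrightarrow>
        norm (remainder s (cis t) r l - remainder s' (cis t) r' l') \<le> M * (\<bar>s - s'\<bar> + norm (r - r') + norm (l - l')))" for R
  proof -
    let ?D = "{0..1::real} \<times> cball (0::complex) 1 \<times> cball (0::complex) R \<times> cball (0::complex) 1"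
    obtain M where M: "M \<ge> 0" "\<And>x. x \<in> ?D \<Longrightarrow> norm (case x of (s, w, r, l) \<Rightarrow> remainder s w r l) \<le> M"
      "\<And>x y. x \<in> ?D \<Longrightarrow> y \<in> ?D \<Longrightarrow> norm ((case x of (s, w, r, l) \<Rightarrow> remainder s w r l) -
          (case y of (s, w, r, l) \<Rightarrow> remainder s w r l)) \<le> M * dist x y"
      using bounded_lipschitz_onE[OF bounded_lipschitz_remainder[of R]] by metis
    have "norm (remainder s (cis t) r l) \<le> M" if "0 \<le> s \<and> s \<le> 1 \<and> norm r \<le> R \<and> norm l \<le> 1" for s t r l
      using M(2)[of "(s, cis t, r, l)"] that by simp
    moreover have "norm (remainder s (cis t) r l - remainder s' (cis t) r' l') \<le> M * (\<bar>s - s'\<bar> + norm (r - r') + norm (l - l'))"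
      if "0 \<le> s \<and> s \<le> 1 \<and> norm r \<le> R \<and> norm l \<le> 1 \<and> 0 \<le> s' \<and> s' \<le> 1 \<and> norm r' \<le> R \<and> norm l' \<le> 1" for s s' t r r' l l'
    proof -
      have "dist (s, cis t, r, l) (s', cis t, r', l') = norm (s - s', 0 :: complex, r - r', l - l')"
        by (simp add: dist_norm)
      also have "\<dots> \<le> \<bar>s - s'\<bar> + (norm (0 :: complex) + (norm (r - r') + norm (l - l')))"
        using norm_Pair_le[of "s - s'" "(0 :: complex, r - r', l - l')"]
          norm_Pair_le[of "0 :: complex" "(r - r', l - l')"] norm_Pair_le[of "r - r'" "l - l'"] by simp
      finally have "dist (s, cis t, r, l) (s', cis t, r', l') \<le> \<bar>s - s'\<bar> + norm (r - r') + norm (l - l')" by simp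
      from mult_left_mono[OF this M(1)] show ?thesis
        using M(3)[of "(s, cis t, r, l)" "(s', cis t, r', l')"] that by simp
    qed
    ultimately show ?thesis using M(1) by blast
  qed
  obtain s1 C r l where s1: "0 < s1" "s1 \<le> 1"
    and r_deriv: "\<And>s t. s \<in> {0..s1} \<Longrightarrow>
      ((r s) has_vector_derivative l s + integrand t (l s) + s *\<^sub>R remainder s (cis t) (r s t) (l s)) (at t)"
    and r_per: "\<And>s t. s \<in> {0..s1} \<Longrightarrow> r s (t + 2 * pi) = r s t" and r_0: "\<And>s. s \<in> {0..s1} \<Longrightarrow> r s 0 = 0"
    and r_bound: "\<And>s t. s \<in> {0..s1} \<Longrightarrow> norm (r s t) \<le> C" and l_bound: "\<And>s. s \<in> {0..s1} \<Longrightarrow> norm (l s) \<le> C * s"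
    and r_lip: "\<And>s s' t. s \<in> {0..s1} \<Longrightarrow> s' \<in> {0..s1} \<Longrightarrow> norm (r s t - r s' t) \<le> C * \<bar>s - s'\<bar>"
    and l_lip: "\<And>s s'. s \<in> {0..s1} \<Longrightarrow> s' \<in> {0..s1} \<Longrightarrow> norm (l s - l s') \<le> C * \<bar>s - s'\<bar>"
  proof (rule periodic_perturbation[of primitive integrand K "\<lambda>s t. remainder s (cis t)"], goal_cases)
    case (4 t l m)
    show ?case
      using norm_primitive_diff[OF B(2), of t l m] mult_right_mono[OF K(1), of "norm (l - m)"] by simp
  next
    case (5 t)
    show ?case using norm_primitive_0[of t] K(2) by simp
  next
    case (6 s t r l)
    show ?case by (simp add: cis.ctr)
  next
    case (8 R)
    show ?case using rem_bl[of R] by blast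
  next
    case (9 R)
    show ?case using rem_bl[of R] by blast
  next
    case (10 s0 C r l)
    show ?case by (rule that[of s0 r l C]) (fact 10)+
  qed (rule primitive_0 primitive_periodic primitive_derivative continuous_remainder; assumption?)+
  have C: "C \<ge> 0"
    using order_trans[OF norm_ge_zero r_bound[of 0 0]] s1 by simp
  \<comment> \<open>Small enough that \<open>s \<bar>\<sigma>\<bar>\<close>, \<open>s \<bar>\<beta>\<bar>\<close> and \<open>s * norm (r s t)\<close> stay below \<open>1/2\<close>: the time scale is then
     positive, the equilibrium stays in the right half plane, and the orbit stays close to a circle.\<close>
  define s0 where "s0 = min s1 (1 / (2 * (B * C + C + 1)))"
  have BC: "B * C \<ge> 0" using B(1) C by simp
  have s0: "s0 > 0" "s0 \<le> s1" "s0 * (B * C + C + 1) \<le> 1 / 2"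
  proof -
    have "s0 \<le> 1 / (2 * (B * C + C + 1))" by (simp add: s0_def)
    then show "s0 * (B * C + C + 1) \<le> 1 / 2" using BC C by (simp add: field_simps)
    show "s0 > 0" "s0 \<le> s1" using s1 BC C by (auto simp: s0_def)
  qed
  define z where "z s t = cis t * (1 + of_real s * r s t)" for s t
  define m where "m s = 1 + s * \<sigma> (l s)" for s
  define \<tau> where "\<tau> s t = \<omega> * t / m s" for s t
  have small: "s \<in> {0..s1}" "s * (B * C) < 1 / 2" "s * C < 1 / 2" "0 < s" "s < 1" if "s \<in> {0<..<s0}" for s
  proof -
    have "s * (B * C + C + 1) < s0 * (B * C + C + 1)"
      using that BC C by (intro mult_strict_right_mono) auto
    then have "s * (B * C) + s * C + s < 1 / 2"
      using s0(3) by (simp add: algebra_simps)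
    moreover have "s * (B * C) \<ge> 0" "s * C \<ge> 0" using that BC C by auto
    ultimately show "s * (B * C) < 1 / 2" "s * C < 1 / 2" "s < 1" using that by auto
    show "s \<in> {0..s1}" "0 < s" using that s0 by auto
  qed
  have beta: "\<bar>\<beta> (l s)\<bar> \<le> B * C" "\<bar>\<sigma> (l s)\<bar> \<le> B * C" if "s \<in> {0<..<s0}" for s
  proof -
    have "C * s \<le> C" using small[OF that] C by (simp add: mult_left_le)
    then have "norm (l s) \<le> C" using l_bound[OF small(1)[OF that]] by simp
    then have "B * norm (l s) \<le> B * C" using B(1) by (intro mult_left_mono) auto
    then show "\<bar>\<beta> (l s)\<bar> \<le> B * C" "\<bar>\<sigma> (l s)\<bar> \<le> B * C" using B(2,3)[of "l s"] by auto
  qed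
  have m: "m s > 0" if "s \<in> {0<..<s0}" for s
  proof -
    have "\<bar>s * \<sigma> (l s)\<bar> \<le> s * (B * C)"
      using beta(2)[OF that] small(4)[OF that] by (simp add: abs_mult)
    then show ?thesis using small(2)[OF that] by (simp add: m_def)
  qed
  have z_deriv: "(z s has_vector_derivative m s *\<^sub>R (\<i> * z s t + s *\<^sub>R field s (\<beta> (l s)) (Re (z s t)))) (at t)"
    if "s \<in> {0<..<s0}" for s t
    unfolding z_def[abs_def] m_def by (rule rotating_frame) (rule r_deriv[OF small(1)[OF that]])
  have z_norm: "norm (z s t) \<le> 2" if "s \<in> {0<..<s0}" for s t
  proof -
    have "norm (of_real s * r s t) \<le> s * C"
      using r_bound[OF small(1)[OF that], of t] small(4)[OF that] by (simp add: norm_mult)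
    then have "norm (1 + of_real s * r s t) \<le> 1 + 1"
      using small(3)[OF that] by (intro norm_triangle_le add_mono) auto
    then show ?thesis by (simp add: z_def norm_mult)
  qed
  have l_cont: "continuous_on {0<..<s0} l"
  proof (rule lipschitz_on_continuous_on[OF lipschitz_onI])
    show "dist (l s) (l s') \<le> C * dist s s'" if "s \<in> {0<..<s0}" "s' \<in> {0<..<s0}" for s s'
      using l_lip[OF small(1) small(1), OF that] by (simp add: dist_norm)
  qed (rule C)
  have beta_cont: "continuous_on {0<..<s0} (\<lambda>s. \<beta> (l s))" "continuous_on {0<..<s0} (\<lambda>s. \<sigma> (l s))"
    unfolding \<sigma>_def \<beta>_def by (intro continuous_intros l_cont)+
  have m_cont: "continuous_on {0<..<s0} m"
    unfolding m_def by (intro continuous_intros beta_cont)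
  have r_cont: "continuous_on ({0<..<s0} \<times> UNIV) (\<lambda>(s, t). r s t)"
  proof (rule continuous_on_Times_lipschitz)
    show "continuous_on UNIV (r s)" if "s \<in> {0<..<s0}" for s
      using r_deriv[OF small(1)[OF that]] by (meson continuous_at_imp_continuous_on has_vector_derivative_continuous)
    show "dist (r s t) (r s' t) \<le> C * dist s s'" if "s \<in> {0<..<s0}" "s' \<in> {0<..<s0}" for s s' t
      using r_lip[OF small(1) small(1), OF that] by (simp add: dist_norm)
  qed
  let ?U = "{0<..<s0} \<times> (UNIV :: real set)"
  have fst_cont: "continuous_on ?U (\<lambda>p. h (fst p))" if "continuous_on {0<..<s0} h" for h :: "real \<Rightarrow> real"
    by (rule continuous_on_compose2[OF that continuous_on_fst[OF continuous_on_id]]) auto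
  have tau_cont: "continuous_on ?U (\<lambda>p. \<tau> (fst p) (snd p))"
    unfolding \<tau>_def using m by (intro continuous_intros fst_cont m_cont) (auto simp: less_imp_neq[symmetric])
  have "continuous_on ?U (\<lambda>p. (fst p, \<tau> (fst p) (snd p)))"
    by (rule continuous_on_Pair[OF continuous_on_fst[OF continuous_on_id] tau_cont])
  from continuous_on_compose2[OF r_cont this]
  have "continuous_on ?U (\<lambda>p. r (fst p) (\<tau> (fst p) (snd p)))"
    by (simp add: image_subset_iff mem_Times_iff)
  then have z_cont: "continuous_on ?U (\<lambda>p. z (fst p) (\<tau> (fst p) (snd p)))"
    unfolding z_def by (intro continuous_intros tau_cont)
  define x where "x s t = 1 / 2 + s * \<beta> (l s) + s * Re (z s (\<omega> * t / m s))" for s t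
  define y where "y s t = 1 / 4 - (s * \<beta> (l s)) ^ 2 - s * \<epsilon> * \<omega> * Im (z s (\<omega> * t / m s))" for s t
  define C' where "C' = B * C + 2 + (B * C) ^ 2 + \<epsilon> * \<omega> * 2"
  have eo: "\<epsilon> * \<omega> > 0" using eps_pos omega by simp
  show thesis
  proof (rule that[of s0 "\<lambda>s. s * \<beta> (l s)" C' x y])
    show "s0 > 0" by (rule s0)
    show "continuous_on {0<..<s0} (\<lambda>s. s * \<beta> (l s))" by (intro continuous_intros beta_cont)
    show "continuous_on ?U (\<lambda>(s, t). x s t)" "continuous_on ?U (\<lambda>(s, t). y s t)"
      unfolding x_def y_def split_beta
      by (intro continuous_intros fst_cont[OF beta_cont(1)] z_cont[unfolded \<tau>_def])+
    fix s assume s: "s \<in> {0<..<s0}"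
    note sp = small(4)[OF s]
    have sb: "\<bar>s * \<beta> (l s)\<bar> \<le> s * (B * C)"
      using beta(1)[OF s] sp by (simp add: abs_mult)
    also have "\<dots> \<le> s * C'"
      using eo sp by (intro mult_left_mono) (auto simp: C'_def)
    finally show "\<bar>s * \<beta> (l s)\<bar> \<le> C' * s" by (simp add: mult.commute)
    show "\<bar>s * \<beta> (l s)\<bar> < 1 / 2" using sb small(2)[OF s] by linarith
    have Re2: "\<bar>s * Re (z s t)\<bar> \<le> s * 2" for t
      using abs_Re_le_cmod[of "z s t"] z_norm[OF s, of t] sp by (simp add: abs_mult)
    show "\<bar>x s t - 1 / 2\<bar> \<le> C' * s" for t
    proof -
      have "\<bar>x s t - 1 / 2\<bar> \<le> s * (B * C) + s * 2"
        unfolding x_def using sb Re2[of "\<omega> * t / m s"] by linarith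
      also have "\<dots> \<le> s * C'"
        unfolding distrib_left[symmetric] using eo sp by (intro mult_left_mono) (auto simp: C'_def)
      finally show ?thesis by (simp add: mult.commute)
    qed
    show "\<bar>y s t - 1 / 4\<bar> \<le> C' * s" for t
    proof -
      have "(s * \<beta> (l s)) ^ 2 = s ^ 2 * \<bar>\<beta> (l s)\<bar> ^ 2" by (simp add: power_mult_distrib)
      also have "\<dots> \<le> s * (B * C) ^ 2"
        using beta(1)[OF s] small(5)[OF s] sp by (intro mult_mono power_mono) (auto simp: power2_eq_square mult_left_le)
      finally have 1: "(s * \<beta> (l s)) ^ 2 \<le> s * (B * C) ^ 2" .
      have "\<bar>s * \<epsilon> * \<omega> * Im (z s (\<omega> * t / m s))\<bar> = s * (\<epsilon> * \<omega> * \<bar>Im (z s (\<omega> * t / m s))\<bar>)"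
        using eps_pos omega sp by (simp add: abs_mult)
      also have "\<dots> \<le> s * (\<epsilon> * \<omega> * 2)"
        using abs_Im_le_cmod[of "z s (\<omega> * t / m s)"] z_norm[OF s, of "\<omega> * t / m s"] eo sp
        by (intro mult_left_mono) auto
      finally have 2: "\<bar>s * \<epsilon> * \<omega> * Im (z s (\<omega> * t / m s))\<bar> \<le> s * (\<epsilon> * \<omega> * 2)" .
      have "\<bar>y s t - 1 / 4\<bar> \<le> (s * \<beta> (l s)) ^ 2 + \<bar>s * \<epsilon> * \<omega> * Im (z s (\<omega> * t / m s))\<bar>"
        unfolding y_def using zero_le_power2[of "s * \<beta> (l s)"] by linarith
      also have "\<dots> \<le> s * (B * C) ^ 2 + s * (\<epsilon> * \<omega> * 2)"
        by (intro add_mono 1 2)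
      also have "\<dots> \<le> s * C'"
        unfolding distrib_left[symmetric] using BC sp by (intro mult_left_mono) (auto simp: C'_def)
      finally show ?thesis by (simp add: mult.commute)
    qed
    have m0: "m s \<noteq> 0" using m[OF s] by simp
    show "((x s) has_real_derivative (y s t + x s t * (x s t - 1)) / \<epsilon>) (at t)" for t
      unfolding x_def[abs_def] y_def by (rule rescaled_solution(1)[OF z_deriv[OF s] m0])
    show "((y s) has_real_derivative - g (x s t) + g (1 / 2 + s * \<beta> (l s))) (at t)" for t
      unfolding x_def y_def[abs_def] by (rule rescaled_solution(2)[OF z_deriv[OF s] m0])
    have z_per: "z s (t + 2 * pi) = z s t" for t
      using r_per[OF small(1)[OF s]] by (simp add: z_def cis.ctr)
    show "\<exists>T>0. \<forall>t. x s (t + T) = x s t \<and> y s (t + T) = y s t"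
    proof (intro exI[of _ "2 * pi * m s / \<omega>"] conjI allI)
      show "2 * pi * m s / \<omega> > 0" using m[OF s] omega by simp
      have "\<omega> * (t + 2 * pi * m s / \<omega>) / m s = \<omega> * t / m s + 2 * pi" for t
        using m0 omega(1) by (simp add: field_simps)
      then show "x s (t + 2 * pi * m s / \<omega>) = x s t" "y s (t + 2 * pi * m s / \<omega>) = y s t" for t
        unfolding x_def y_def by (simp_all only: z_per)
    qed
    have "Re (z s 0) = 1" using r_0[OF small(1)[OF s]] by (simp add: z_def)
    moreover have "Re (z s pi) < 0"
    proof -
      have "\<bar>Re (r s pi)\<bar> \<le> C"
        using abs_Re_le_cmod[of "r s pi"] r_bound[OF small(1)[OF s], of pi] by simp
      then have "\<bar>s * Re (r s pi)\<bar> \<le> s * C" using sp by (simp add: abs_mult)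
      then show ?thesis using small(3)[OF s] by (simp add: z_def)
    qed
    ultimately have "Re (z s (\<omega> * (pi * m s / \<omega>) / m s)) \<noteq> Re (z s (\<omega> * 0 / m s))"
      using m0 omega(1) by simp
    then show "\<exists>t. x s t \<noteq> x s 0"
      by (intro exI[of _ "pi * m s / \<omega>"]) (use sp in \<open>simp add: x_def\<close>)
  qed
qed

end

section \<open>The Hopf bifurcation\<close>

lemma vector_2_eq: "vector [u, v] = u *\<^sub>R axis 1 1 + v *\<^sub>R (axis 2 1 :: real ^ 2)"
  by (simp add: vec_eq_iff forall_2 axis_def)

lemma has_vector_derivative_vector_2:
  assumes "(u has_real_derivative u') (at t)" "(v has_real_derivative v') (at t)"
  shows "((\<lambda>t. vector [u t, v t] :: real ^ 2) has_vector_derivative vector [u', v']) (at t)"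
  using has_vector_derivative_add[OF
      has_vector_derivative_scaleR[OF assms(1) has_vector_derivative_const[of "axis 1 1 :: real ^ 2"]]
      has_vector_derivative_scaleR[OF assms(2) has_vector_derivative_const[of "axis 2 1 :: real ^ 2"]]]
  by (simp add: vector_2_eq)

lemma dist_vector_2_le: "dist (vector [u, v] :: real ^ 2) (vector [u', v']) \<le> \<bar>u - u'\<bar> + \<bar>v - v'\<bar>"
  using norm_le_l1_cart[of "vector [u, v] - vector [u', v'] :: real ^ 2"] by (simp add: dist_norm sum_2)

lemma planar_field_periodic_orbits:
  assumes "N \<ge> 1" "\<epsilon> > 0"
  defines "rc \<equiv> \<Sum>n=1..N. (1 / 2 :: real) ^ n"
  shows "\<exists>s0>0. \<exists>p :: real \<Rightarrow> real. \<exists>x :: real \<Rightarrow> real \<Rightarrow> real ^ 2.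
           continuous_on {0<..<s0} p \<and>
           continuous_on ({0<..<s0} \<times> UNIV) (\<lambda>(s, t). x s t) \<and>
           (\<forall>s\<in>{0<..<s0}. p s \<in> {0<..} \<and> nonconstant_periodic_solution (planar_field N \<epsilon> (p s)) (x s)) \<and>
           (p \<longlongrightarrow> rc) (at_right 0) \<and>
           uniform_limit UNIV x (\<lambda>t. vector [1 / 2, 1 / 4]) (at_right 0)"
proof -
  define g where "g x = (\<Sum>n=1..N. x ^ n)" for x :: real
  define g1 where "g1 = (\<Sum>n=1..N. real n * (1 / 2) ^ (n - 1))"
  have g_cont: "isCont g x" for x
    unfolding g_def by (rule DERIV_isCont[OF has_real_derivative_power_sum])
  have g_pos: "g x > 0" if "x > 0" for x
    unfolding g_def using that assms(1) by (intro sum_pos) auto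
  obtain g2 q where "\<And>h. g (1 / 2 + h) = g (1 / 2) + g1 * h + g2 * h ^ 2 + h ^ 3 * poly q h"
  proof (rule power_sum_expansion[where N=N and c="1 / 2"], goal_cases)
    case (1 c2 q)
    show ?case by (rule that[of c2 q], unfold g_def g1_def) (fact 1)
  qed
  then interpret focus_expansion g \<epsilon> g1 g2 q
    using assms power_sum_deriv_pos[of N "1 / 2"] by unfold_locales (auto simp: g1_def)
  obtain s0 C b x y where s0: "s0 > 0"
    and b: "continuous_on {0<..<s0} b" "\<And>s. s \<in> {0<..<s0} \<Longrightarrow> \<bar>b s\<bar> \<le> C * s" "\<And>s. s \<in> {0<..<s0} \<Longrightarrow> \<bar>b s\<bar> < 1 / 2"
    and cont: "continuous_on ({0<..<s0} \<times> UNIV) (\<lambda>(s, t). x s t)" "continuous_on ({0<..<s0} \<times> UNIV) (\<lambda>(s, t). y s t)"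
    and bound: "\<And>s t. s \<in> {0<..<s0} \<Longrightarrow> \<bar>x s t - 1 / 2\<bar> \<le> C * s" "\<And>s t. s \<in> {0<..<s0} \<Longrightarrow> \<bar>y s t - 1 / 4\<bar> \<le> C * s"
    and deriv: "\<And>s t. s \<in> {0<..<s0} \<Longrightarrow> ((x s) has_real_derivative (y s t + x s t * (x s t - 1)) / \<epsilon>) (at t)"
    "\<And>s t. s \<in> {0<..<s0} \<Longrightarrow> ((y s) has_real_derivative - g (x s t) + g (1 / 2 + b s)) (at t)"
    and per: "\<And>s. s \<in> {0<..<s0} \<Longrightarrow> \<exists>T>0. \<forall>t. x s (t + T) = x s t \<and> y s (t + T) = y s t"
    and nonconst: "\<And>s. s \<in> {0<..<s0} \<Longrightarrow> \<exists>t. x s t \<noteq> x s 0"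
  proof (rule periodic_orbit_family, goal_cases)
    case (1 s0 C b x y)
    show ?case by (rule that[of s0 b C x y]) (fact 1)+
  qed
  define p where "p s = g (1 / 2 + b s)" for s
  define X where "X s t = (vector [x s t, y s t] :: real ^ 2)" for s t
  have near: "\<forall>\<^sub>F s in at_right 0. s \<in> {0<..<\<delta>}" if "\<delta> > 0" for \<delta> :: real
    by (rule eventually_at_right_real[OF that])
  have "continuous_on {0<..<s0} p"
    unfolding p_def
    by (rule continuous_on_compose2[of UNIV g _ "\<lambda>s. 1 / 2 + b s"])
       (intro continuous_at_imp_continuous_on ballI g_cont continuous_on_add continuous_on_const b(1) subset_UNIV)+
  moreover have "continuous_on ({0<..<s0} \<times> UNIV) (\<lambda>(s, t). X s t)"
    using cont unfolding X_def vector_2_eq split_beta by (intro continuous_intros)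
  moreover have "p s \<in> {0<..} \<and> nonconstant_periodic_solution (planar_field N \<epsilon> (p s)) (X s)" if s: "s \<in> {0<..<s0}" for s
    unfolding nonconstant_periodic_solution_def
  proof (intro conjI allI)
    show "p s \<in> {0<..}"
      using g_pos b(3)[OF s] by (auto simp: p_def abs_less_iff)
    have "planar_field N \<epsilon> (p s) (X s t) = vector [(y s t + x s t * (x s t - 1)) / \<epsilon>, - g (x s t) + g (1 / 2 + b s)]" for t
      by (simp add: planar_field_def Let_def X_def p_def g_def)
    then show "(X s has_vector_derivative planar_field N \<epsilon> (p s) (X s t)) (at t)" for t
      unfolding X_def[abs_def] using has_vector_derivative_vector_2[OF deriv[OF s]] by simp
    show "\<exists>T>0. \<forall>t. X s (t + T) = X s t"
      using per[OF s] by (auto simp: X_def)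
    show "\<exists>t. X s t \<noteq> X s 0"
      using nonconst[OF s] unfolding X_def by (metis vector_2(1))
  qed
  moreover have "(p \<longlongrightarrow> rc) (at_right 0)"
  proof -
    have "(b \<longlongrightarrow> 0) (at_right 0)"
    proof (rule Lim_null_comparison)
      show "\<forall>\<^sub>F s in at_right 0. norm (b s) \<le> C * s"
        using near[OF s0] by eventually_elim (use b(2) in auto)
      show "((\<lambda>s. C * s) \<longlongrightarrow> 0) (at_right 0)"
        by (intro tendsto_eq_intros) auto
    qed
    then have "((\<lambda>s. 1 / 2 + b s) \<longlongrightarrow> 1 / 2) (at_right 0)"
      using tendsto_add[OF tendsto_const[of "1 / 2 :: real"]] by force
    from isCont_tendsto_compose[OF g_cont this] show ?thesis
      by (simp add: p_def[abs_def] rc_def g_def)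
  qed
  moreover have "uniform_limit UNIV X (\<lambda>t. vector [1 / 2, 1 / 4]) (at_right 0)"
    unfolding uniform_limit_iff
  proof (intro allI impI)
    fix e :: real assume "e > 0"
    define \<delta> where "\<delta> = min s0 (e / (2 * \<bar>C\<bar> + 1))"
    have "\<delta> > 0" using s0 \<open>e > 0\<close> by (simp add: \<delta>_def)
    show "\<forall>\<^sub>F s in at_right 0. \<forall>t\<in>UNIV. dist (X s t) (vector [1 / 2, 1 / 4]) < e"
      using near[OF \<open>\<delta> > 0\<close>]
    proof eventually_elim
      case (elim s)
      then have s: "s \<in> {0<..<s0}" "s > 0" "(2 * \<bar>C\<bar> + 1) * s < e"
        by (auto simp: \<delta>_def field_simps)
      have "C * s \<le> \<bar>C\<bar> * s" using s(2) by (intro mult_right_mono) auto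
      moreover have "(2 * \<bar>C\<bar> + 1) * s = 2 * (\<bar>C\<bar> * s) + s" by (simp add: algebra_simps)
      ultimately have "2 * (C * s) < e" using s(2,3) by linarith
      then have "dist (X s t) (vector [1 / 2, 1 / 4]) < e" for t
        using dist_vector_2_le[of "x s t" "y s t" "1 / 2" "1 / 4"] bound[OF s(1), of t]
        unfolding X_def by linarith
      then show ?case by simp
    qed
  qed
  ultimately show ?thesis
    using s0 by blast
qed

theorem theorem1:
  fixes N :: nat and \<epsilon> :: real
  assumes "N \<ge> 5" and "odd N" and "\<epsilon> > 0"
  shows "hopf_bifurcation {0<..} (planar_field N \<epsilon>) (\<Sum>n=1..N. (1/2) ^ n)"
proof -
  define rc :: real where "rc = (\<Sum>n=1..N. (1/2) ^ n)"
  define g' where "g' x = (\<Sum>n=1..N. real n * x ^ (n - 1))" for x :: real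
  have N: "N \<ge> 1" using assms by simp
  have g'_pos: "g' x > 0" if "x \<ge> 0" for x
    unfolding g'_def by (rule power_sum_deriv_pos[OF N that])
  obtain a :: "real \<Rightarrow> real" where a_pos: "\<And>r. r > 0 \<Longrightarrow> a r > 0"
    and ga: "\<And>r. r > 0 \<Longrightarrow> (\<Sum>n=1..N. a r ^ n) = r"
    and ag: "\<And>x. x > 0 \<Longrightarrow> a (\<Sum>n=1..N. x ^ n) = x"
    and a_deriv: "\<And>r. r > 0 \<Longrightarrow> (a has_real_derivative inverse (g' (a r))) (at r)"
  proof (rule power_sum_inverse[OF N], goal_cases)
    case (1 a)
    show ?case by (rule that[of a], unfold g'_def) (fact 1)+
  qed
  have rc: "rc > 0" "a rc = 1 / 2"
    using ag[of "1 / 2"] N by (auto simp: rc_def intro!: sum_pos)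
  \<comment> \<open>Where this is positive the two eigenvalues are not real.\<close>
  define disc where "disc r = 4 * \<epsilon> * g' (a r) - (2 * a r - 1) ^ 2" for r
  have a_cont: "isCont a rc" by (rule DERIV_isCont[OF a_deriv[OF rc(1)]])
  have "isCont g' x" for x
    unfolding g'_def by (rule continuous_polymonial_function[OF polynomial_function_power_sum_deriv])
  from isCont_o2[OF a_cont this] have "isCont disc rc"
    unfolding disc_def by (intro continuous_intros a_cont)
  moreover have "disc rc > 0"
    using g'_pos[of "1 / 2"] assms(3) by (simp add: disc_def rc)
  ultimately have "\<forall>\<^sub>F r in at rc. disc r > 0"
    unfolding isCont_def by (rule order_tendstoD(1))
  then obtain e0 where e0: "e0 > 0" "\<And>r. dist r rc < e0 \<Longrightarrow> disc r > 0"
    using \<open>disc rc > 0\<close> unfolding eventually_at by (metis UNIV_I)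
  define e where "e = min e0 rc"
  have e: "e > 0" using e0 rc by (simp add: e_def)
  have ball: "r > 0" "disc r > 0" if "r \<in> ball rc e" for r
    using that e0(2)[of r] by (auto simp: e_def dist_real_def)
  define z where "z r = (vector [a r, a r * (1 - a r)] :: real ^ 2)" for r
  define mu where "mu r = Complex ((2 * a r - 1) / (2 * \<epsilon>)) (sqrt (disc r) / (2 * \<epsilon>))" for r
  have z_smooth: "smooth_on (ball rc e) z"
    unfolding smooth_on_def
  proof
    fix k
    have "polynomial_function (\<lambda>x. vector [x, x * (1 - x)] :: real ^ 2)"
    proof -
      have "real_polynomial_function (\<lambda>x :: real. x)" "real_polynomial_function (\<lambda>x :: real. x * (1 - x))"
        unfolding real_polynomial_function_eq
        by (intro polynomial_function_mult[where 'b=real, unfolded real_scaleR_def] polynomial_function_diff polynomial_function_const polynomial_function_id)+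
      then show ?thesis
        by (auto simp: polynomial_function_iff_Basis_inner Basis_vec_def inner_axis UNIV_2)
    qed
    then have "Ck_on k (ball rc e) (\<lambda>r. inverse (g' (a r)) ^ 0 *\<^sub>R (vector [a r, a r * (1 - a r)] :: real ^ 2))"
    proof (rule Ck_on_rational_solution[OF open_ball, rotated 3])
      show "polynomial_function g'"
        unfolding g'_def by (rule polynomial_function_power_sum_deriv)
      show "g' (a r) \<noteq> 0" if "r \<in> ball rc e" for r
        using g'_pos[of "a r"] a_pos[OF ball(1)[OF that]] by simp
      show "(a has_real_derivative inverse (g' (a r))) (at r)" if "r \<in> ball rc e" for r
        by (rule a_deriv[OF ball(1)[OF that]])
    qed
    then show "Ck_on k (ball rc e) z"
      by (simp add: z_def[abs_def])
  qed
  have equilibrium: "planar_field N \<epsilon> r (z r) = 0" if "r \<in> ball rc e" for r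
    using ga[OF ball(1)[OF that]]
    by (simp add: planar_field_def Let_def z_def vec_eq_iff forall_2 algebra_simps)
  have eigen: "complex_eigenvalue (jacobian (planar_field N \<epsilon> r) (at (z r))) (mu r)"
    "complex_eigenvalue (jacobian (planar_field N \<epsilon> r) (at (z r))) (cnj (mu r))" "Im (mu r) > 0"
    if "r \<in> ball rc e" for r
  proof -
    have D: "sqrt (disc r) ^ 2 = 4 * \<epsilon> * g' (a r) - (2 * a r - 1) ^ 2"
      "(- sqrt (disc r)) ^ 2 = 4 * \<epsilon> * g' (a r) - (2 * a r - 1) ^ 2"
      using ball(2)[OF that] by (simp_all add: disc_def)
    have J: "jacobian (planar_field N \<epsilon> r) (at (z r)) =
        vector [vector [(2 * a r - 1) / \<epsilon>, 1 / \<epsilon>], vector [- g' (a r), 0]]"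
      by (simp add: jacobian_planar_field z_def g'_def)
    show "complex_eigenvalue (jacobian (planar_field N \<epsilon> r) (at (z r))) (mu r)"
      unfolding J mu_def using assms(3) by (intro focus_eigenvalue D(1)) simp
    have "cnj (mu r) = Complex ((2 * a r - 1) / (2 * \<epsilon>)) (- sqrt (disc r) / (2 * \<epsilon>))"
      by (simp add: mu_def complex_eq_iff)
    then show "complex_eigenvalue (jacobian (planar_field N \<epsilon> r) (at (z r))) (cnj (mu r))"
      unfolding J using focus_eigenvalue[OF _ D(2)] assms(3) by simp
    show "Im (mu r) > 0"
      using ball(2)[OF that] assms(3) by (simp add: mu_def)
  qed
  have crossing: "((\<lambda>r. Re (mu r)) has_real_derivative inverse (g' (1 / 2)) / \<epsilon>) (at rc)"
    "inverse (g' (1 / 2)) / \<epsilon> \<noteq> 0"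
  proof -
    have "((\<lambda>r. (2 * a r - 1) / (2 * \<epsilon>)) has_real_derivative (2 * inverse (g' (a rc)) - 0) / (2 * \<epsilon>)) (at rc)"
      by (intro DERIV_cdivide DERIV_diff DERIV_cmult DERIV_const a_deriv rc)
    then show "((\<lambda>r. Re (mu r)) has_real_derivative inverse (g' (1 / 2)) / \<epsilon>) (at rc)"
      using rc assms(3) by (simp add: mu_def)
    show "inverse (g' (1 / 2)) / \<epsilon> \<noteq> 0"
      using g'_pos[of "1 / 2"] assms(3) by simp
  qed
  have "z rc = vector [1 / 2, 1 / 4]" by (simp add: z_def rc)
  then have orbits: "\<exists>s0>0. \<exists>p :: real \<Rightarrow> real. \<exists>x :: real \<Rightarrow> real \<Rightarrow> real ^ 2.
           continuous_on {0<..<s0} p \<and>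
           continuous_on ({0<..<s0} \<times> UNIV) (\<lambda>(s, t). x s t) \<and>
           (\<forall>s\<in>{0<..<s0}. p s \<in> {0<..} \<and> nonconstant_periodic_solution (planar_field N \<epsilon> (p s)) (x s)) \<and>
           (p \<longlongrightarrow> rc) (at_right 0) \<and>
           uniform_limit UNIV x (\<lambda>t. z rc) (at_right 0)"
    using planar_field_periodic_orbits[OF N assms(3)] unfolding rc_def by simp
  have "ball rc e \<subseteq> {0<..}" using ball by auto
  moreover have "Re (mu rc) = 0" by (simp add: mu_def rc)
  ultimately show ?thesis
    unfolding hopf_bifurcation_def rc_def[symmetric]
  proof (intro conjI, goal_cases)
    case 4
    show ?case
      by (rule exI[of _ e], rule conjI[OF e], rule exI[of _ z], rule exI[of _ mu],
          rule exI[of _ "inverse (g' (1 / 2)) / \<epsilon>"], intro conjI ballI)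
         (fact 4 z_smooth crossing orbits | rule equilibrium eigen, assumption)+
  qed (use rc(1) smooth_on_planar_field in auto)
qed

end
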